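(* Let $k$ be an algebraically closed field and let $G_{1},\ldots ,G_{n}$ be finitely presented groups. Then there exist a finite, connected quiver $\hat{Q}$ without oriented cycles and admissible ideals $I_{1},\ldots ,I_{n}$ of the path algebra $k\hat{Q}$ such that $k\hat{Q}/I_{1}\cong k\hat{Q}/I_{2}\cong \cdots \cong k\hat{Q}/I_{n}$ (i.e. the $(\hat{Q},I_{i})$ are presentations of one and the same triangular algebra $A$) and $\pi _{1}(\hat{Q},I_{i})\cong G_{i}$ for every $i=1,\ldots ,n$.
   Context: A quiver $Q$ consists of finite sets of vertices $Q_0$ and arrows $Q_1$ with source and target maps; $kQ$ is its path algebra (basis: all paths, including a stationary path $e_x$ for each vertex $x$). Let $F$ be the two-sided ideal of $kQ$ generated by the arrows. A two-sided ideal $I$ of $kQ$ is admissible if $F^{m}\subseteq I\subseteq F^{2}$ for some $m\geq 2$. A presentation of a basic connected finite-dimensional $k$-algebra $A$ is a pair $(Q,I)$ with $I$ admissible and $kQ/I\cong A$. $A$ (or $Q$) is triangular if $Q$ has no oriented cycles. Fundamental group: for vertices $x,y$ let $I(x,y)=e_x(kQ)e_y\cap I$. A relation $\rho=\sum_{i=1}^{m}\lambda_i w_i\in I(x,y)$ (with $\lambda_i\in k^{*}$ and $w_i$ distinct paths from $x$ to $y$) is minimal if $m\geq 2$ and for every proper nonempty subset $J\subset\{1,\ldots,m\}$, $\sum_{i\in J}\lambda_i w_i\notin I(x,y)$. For each arrow $\alpha:x\to y$ let $\alpha^{-1}$ be a formal inverse from $y$ to $x$; a walk is a composable sequence of arrows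 and formal inverses. Homotopy $\sim$ is the smallest equivalence relation on walks such that $\alpha\alpha^{-1}\sim e_x$, $\alpha^{-1}\alpha\sim e_y$ for every arrow $\alpha:x\to y$; $w_i\sim w_j$ for all paths $w_i,w_j$ occurring in a common minimal relation $\sum\lambda_i w_i$ of $I$; and $u\sim v$ implies $wuw'\sim wvw'$ whenever defined. For a vertex $v_0$, $\pi_1(Q,I,v_0)$ is the group of homotopy classes of closed walks at $v_0$ under concatenation; for connected $Q$ it is independent of $v_0$ and denoted $\pi_1(Q,I)$. *)

theory Defs
  imports "HOL-Algebra.Group" "HOL-Computational_Algebra.Polynomial"
begin

definition alg_closed_field :: "'k::field itself \<Rightarrow> bool" where
  "alg_closed_field _ \<longleftrightarrow> (\<forall>p::'k poly. degree p > 0 \<longrightarrow> (\<exists>x. poly p x = 0))"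

record quiver =
  verts :: "nat set"
  arrs  :: "nat set"
  src   :: "nat \<Rightarrow> nat"
  tgt   :: "nat \<Rightarrow> nat"

definition finite_quiver :: "quiver \<Rightarrow> bool" where
  "finite_quiver Q \<longleftrightarrow> finite (verts Q) \<and> finite (arrs Q) \<and>
     (\<forall>a\<in>arrs Q. src Q a \<in> verts Q \<and> tgt Q a \<in> verts Q)"

text \<open>A walk is a start vertex together with a list of steps (a, True) = arrow a,
  (a, False) = formal inverse of a. walk_end returns the end vertex, or None
  if the walk is not composable.\<close>

fun walk_end :: "quiver \<Rightarrow> nat \<Rightarrow> (nat \<times> bool) list \<Rightarrow> nat option" where
  "walk_end Q x [] = (if x \<in> verts Q then Some x else None)"
| "walk_end Q x ((a, d) # s) =
     (if x \<in> verts Q \<and> a \<in> arrs Q \<and> (if d then src Q a else tgt Q a) = x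
      then walk_end Q (if d then tgt Q a else src Q a) s else None)"

type_synonym walk = "nat \<times> (nat \<times> bool) list"
type_synonym path = "nat \<times> nat list"   \<comment> \<open>start vertex, arrows composed left to right\<close>

definition fwd :: "nat list \<Rightarrow> (nat \<times> bool) list" where
  "fwd as = map (\<lambda>a. (a, True)) as"

definition is_path :: "quiver \<Rightarrow> path \<Rightarrow> bool" where
  "is_path Q p \<longleftrightarrow> walk_end Q (fst p) (fwd (snd p)) \<noteq> None"

definition path_end :: "quiver \<Rightarrow> path \<Rightarrow> nat" where
  "path_end Q p = the (walk_end Q (fst p) (fwd (snd p)))"

definition connected_quiver :: "quiver \<Rightarrow> bool" where
  "connected_quiver Q \<longleftrightarrow> verts Q \<noteq> {} \<and>
     (\<forall>x\<in>verts Q. \<forall>y\<in>verts Q. \<exists>s. walk_end Q x s = Some y)"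

definition no_oriented_cycles :: "quiver \<Rightarrow> bool" where
  "no_oriented_cycles Q \<longleftrightarrow>
     \<not> (\<exists>x as. as \<noteq> [] \<and> is_path Q (x, as) \<and> path_end Q (x, as) = x)"

definition path_alg :: "quiver \<Rightarrow> (path \<Rightarrow> 'k::field) set" where
  "path_alg Q = {f. finite {p. f p \<noteq> 0} \<and> (\<forall>p. f p \<noteq> 0 \<longrightarrow> is_path Q p)}"

definition pa_add :: "(path \<Rightarrow> 'k::field) \<Rightarrow> (path \<Rightarrow> 'k) \<Rightarrow> path \<Rightarrow> 'k" where
  "pa_add f g = (\<lambda>p. f p + g p)"

definition pa_diff :: "(path \<Rightarrow> 'k::field) \<Rightarrow> (path \<Rightarrow> 'k) \<Rightarrow> path \<Rightarrow> 'k" where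
  "pa_diff f g = (\<lambda>p. f p - g p)"

definition pa_smult :: "'k::field \<Rightarrow> (path \<Rightarrow> 'k) \<Rightarrow> path \<Rightarrow> 'k" where
  "pa_smult c f = (\<lambda>p. c * f p)"

text \<open>Multiplication: bilinear extension of concatenation of paths (the product
  of two non-composable paths is zero).\<close>

definition pa_mult :: "quiver \<Rightarrow> (path \<Rightarrow> 'k::field) \<Rightarrow> (path \<Rightarrow> 'k) \<Rightarrow> path \<Rightarrow> 'k" where
  "pa_mult Q f g = (\<lambda>(x, as). if is_path Q (x, as) then
      (\<Sum>i\<in>{0..length as}. f (x, take i as) * g (path_end Q (x, take i as), drop i as))
    else 0)"

definition pa_one :: "quiver \<Rightarrow> path \<Rightarrow> 'k::field" where
  "pa_one Q = (\<lambda>p. if snd p = [] \<and> fst p \<in> verts Q then 1 else 0)"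

definition arrow_elt :: "quiver \<Rightarrow> nat \<Rightarrow> path \<Rightarrow> 'k::field" where
  "arrow_elt Q a = (\<lambda>p. if p = (src Q a, [a]) then 1 else 0)"

definition pa_ideal :: "quiver \<Rightarrow> (path \<Rightarrow> 'k::field) set \<Rightarrow> bool" where
  "pa_ideal Q I \<longleftrightarrow> I \<subseteq> path_alg Q \<and> (\<lambda>_. 0) \<in> I \<and>
     (\<forall>a\<in>I. \<forall>b\<in>I. pa_add a b \<in> I) \<and> (\<forall>a\<in>I. \<forall>c. pa_smult c a \<in> I) \<and>
     (\<forall>a\<in>I. \<forall>f\<in>path_alg Q. pa_mult Q f a \<in> I \<and> pa_mult Q a f \<in> I)"

definition gen_ideal :: "quiver \<Rightarrow> (path \<Rightarrow> 'k::field) set \<Rightarrow> (path \<Rightarrow> 'k) set" where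
  "gen_ideal Q S = \<Inter>{I. pa_ideal Q I \<and> S \<subseteq> I}"

definition arrow_ideal :: "quiver \<Rightarrow> (path \<Rightarrow> 'k::field) set" where
  "arrow_ideal Q = gen_ideal Q (arrow_elt Q ` arrs Q)"

fun ideal_power :: "quiver \<Rightarrow> (path \<Rightarrow> 'k::field) set \<Rightarrow> nat \<Rightarrow> (path \<Rightarrow> 'k) set" where
  "ideal_power Q J 0 = path_alg Q"
| "ideal_power Q J (Suc m) =
     gen_ideal Q {pa_mult Q a b | a b. a \<in> ideal_power Q J m \<and> b \<in> J}"

definition admissible :: "quiver \<Rightarrow> (path \<Rightarrow> 'k::field) set \<Rightarrow> bool" where
  "admissible Q I \<longleftrightarrow> pa_ideal Q I \<and>
     (\<exists>m\<ge>2. ideal_power Q (arrow_ideal Q) m \<subseteq> I) \<and> I \<subseteq> ideal_power Q (arrow_ideal Q) 2"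

text \<open>kQ/I \<cong> kQ/J as k-algebras, expressed through a lift phi : kQ \<rightarrow> kQ of the
  isomorphism (every isomorphism of the quotients admits such a lift).\<close>

definition quotients_iso :: "quiver \<Rightarrow> (path \<Rightarrow> 'k::field) set \<Rightarrow> (path \<Rightarrow> 'k) set \<Rightarrow> bool" where
  "quotients_iso Q I J \<longleftrightarrow> (\<exists>\<phi>.
     (\<forall>a\<in>path_alg Q. \<phi> a \<in> path_alg Q) \<and>
     (\<forall>a\<in>path_alg Q. \<forall>b\<in>path_alg Q. pa_diff a b \<in> I \<longleftrightarrow> pa_diff (\<phi> a) (\<phi> b) \<in> J) \<and>
     (\<forall>c\<in>path_alg Q. \<exists>a\<in>path_alg Q. pa_diff (\<phi> a) c \<in> J) \<and>
     (\<forall>a\<in>path_alg Q. \<forall>b\<in>path_alg Q. pa_diff (\<phi> (pa_add a b)) (pa_add (\<phi> a) (\<phi> b)) \<in> J) \<and>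
     (\<forall>a\<in>path_alg Q. \<forall>c. pa_diff (\<phi> (pa_smult c a)) (pa_smult c (\<phi> a)) \<in> J) \<and>
     (\<forall>a\<in>path_alg Q. \<forall>b\<in>path_alg Q. pa_diff (\<phi> (pa_mult Q a b)) (pa_mult Q (\<phi> a) (\<phi> b)) \<in> J) \<and>
     pa_diff (\<phi> (pa_one Q)) (pa_one Q) \<in> J)"

definition supp :: "(path \<Rightarrow> 'k::field) \<Rightarrow> path set" where
  "supp \<rho> = {p. \<rho> p \<noteq> 0}"

definition minimal_relation :: "quiver \<Rightarrow> (path \<Rightarrow> 'k::field) set \<Rightarrow> (path \<Rightarrow> 'k) \<Rightarrow> bool" where
  "minimal_relation Q I \<rho> \<longleftrightarrow> \<rho> \<in> I \<and>
     (\<exists>x y. \<forall>p\<in>supp \<rho>. fst p = x \<and> path_end Q p = y) \<and>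
     card (supp \<rho>) \<ge> 2 \<and>
     (\<forall>K. K \<subset> supp \<rho> \<and> K \<noteq> {} \<longrightarrow> (\<lambda>p. if p \<in> K then \<rho> p else 0) \<notin> I)"

inductive htpy :: "quiver \<Rightarrow> (path \<Rightarrow> 'k::field) set \<Rightarrow> walk \<Rightarrow> walk \<Rightarrow> bool"
  for Q :: quiver and I :: "(path \<Rightarrow> 'k::field) set" where
  h_refl: "walk_end Q x s \<noteq> None \<Longrightarrow> htpy Q I (x, s) (x, s)"
| h_sym: "htpy Q I u v \<Longrightarrow> htpy Q I v u"
| h_trans: "htpy Q I u v \<Longrightarrow> htpy Q I v w \<Longrightarrow> htpy Q I u w"
| h_cancel1: "a \<in> arrs Q \<Longrightarrow> htpy Q I (src Q a, [(a, True), (a, False)]) (src Q a, [])"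
| h_cancel2: "a \<in> arrs Q \<Longrightarrow> htpy Q I (tgt Q a, [(a, False), (a, True)]) (tgt Q a, [])"
| h_rel: "minimal_relation Q I \<rho> \<Longrightarrow> p \<in> supp \<rho> \<Longrightarrow> q \<in> supp \<rho> \<Longrightarrow>
          htpy Q I (fst p, fwd (snd p)) (fst q, fwd (snd q))"
| h_ctx: "htpy Q I (x, u) (x, v) \<Longrightarrow> walk_end Q z w = Some x \<Longrightarrow>
          walk_end Q z (w @ u @ w') \<noteq> None \<Longrightarrow> walk_end Q z (w @ v @ w') \<noteq> None \<Longrightarrow>
          htpy Q I (z, w @ u @ w') (z, w @ v @ w')"

definition quot_monoid :: "('w \<Rightarrow> 'w \<Rightarrow> bool) \<Rightarrow> 'w set \<Rightarrow> ('w \<Rightarrow> 'w \<Rightarrow> 'w) \<Rightarrow> 'w \<Rightarrow> 'w set monoid" where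
  "quot_monoid R D app e =
     \<lparr>carrier = (\<lambda>w. {v. R w v}) ` D,
      monoid.mult = (\<lambda>A B. {v. R (app (SOME a. a \<in> A \<inter> D) (SOME b. b \<in> B \<inter> D)) v}),
      monoid.one = {v. R e v}\<rparr>"

definition pi1 :: "quiver \<Rightarrow> (path \<Rightarrow> 'k::field) set \<Rightarrow> nat \<Rightarrow> walk set monoid" where
  "pi1 Q I v0 = quot_monoid (htpy Q I) {(v0, s) | s. walk_end Q v0 s = Some v0}
     (\<lambda>(x, s) (y, t). (x, s @ t)) (v0, [])"

text \<open>Words over generators: (x, True) = x, (x, False) = x^-1.  The group
  presented by generators X and relators R is the set of words over X modulo
  free cancellation and insertion/deletion of relators.\<close>

inductive pres_eq :: "(nat \<times> bool) list set \<Rightarrow> (nat \<times> bool) list \<Rightarrow> (nat \<times> bool) list \<Rightarrow> bool"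
  for R where
  pe_refl: "pres_eq R u u"
| pe_sym: "pres_eq R u v \<Longrightarrow> pres_eq R v u"
| pe_trans: "pres_eq R u v \<Longrightarrow> pres_eq R v w \<Longrightarrow> pres_eq R u w"
| pe_cancel: "pres_eq R (u @ [(x, b), (x, \<not> b)] @ v) (u @ v)"
| pe_rel: "r \<in> R \<Longrightarrow> pres_eq R (u @ r @ v) (u @ v)"

definition presented_group :: "nat set \<Rightarrow> (nat \<times> bool) list set \<Rightarrow> (nat \<times> bool) list set monoid" where
  "presented_group X R = quot_monoid (pres_eq R) (lists (X \<times> UNIV)) (@) []"

definition finitely_presented :: "('g, 'm) monoid_scheme \<Rightarrow> bool" where
  "finitely_presented G \<longleftrightarrow> group G \<and>
     (\<exists>X R. finite X \<and> finite R \<and> R \<subseteq> lists (X \<times> UNIV) \<and> G \<cong> presented_group X R)"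

end

theory Submission
  imports Defs "HOL-Library.Function_Algebras" "HOL-Library.Countable"
begin

text \<open>
  All groups are realised at once on a quiver whose paths have length at most 2. Arrows
  \<open>\<alpha> t: 0 \<rightarrow> 1\<close> and \<open>\<beta> t: 1 \<rightarrow> 2\<close> are labelled by a common unit \<open>1\<close> and by the nonempty words of
  bounded length over the generators of each group; there are two further arrows \<open>\<gamma>: 1 \<rightarrow> 3\<close> and
  \<open>\<delta>: 4 \<rightarrow> 1\<close>. A base ideal is spanned by the binomials \<open>\<alpha> u \<beta> v - \<alpha> u' \<beta> v'\<close>, whenever
  \<open>u v = u' v'\<close> holds in one of the groups, and by the monomials \<open>\<alpha> t \<gamma>\<close> and \<open>\<delta> \<beta> t\<close> for \<open>t \<noteq> 1\<close>.
  The binomials force the multiplication of the group on the loops \<open>\<alpha> t (\<alpha> 1)\<^sup>-\<^sup>1\<close>, whereas monomials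
  have no effect on homotopy. The \<open>i\<close>-th ideal is the image of the base ideal under the automorphism
  that replaces \<open>\<alpha> t\<close>, \<open>\<beta> t\<close> by \<open>\<alpha> t - \<alpha> 1\<close>, \<open>\<beta> t - \<beta> 1\<close> for all labels \<open>t\<close> from the other groups.
  This turns \<open>\<alpha> t \<gamma>\<close> and \<open>\<delta> \<beta> t\<close> into the minimal relations \<open>(\<alpha> t - \<alpha> 1) \<gamma>\<close> and \<open>\<delta> (\<beta> t - \<beta> 1)\<close>, which
  kill \<open>t\<close> in the fundamental group. No further homotopies arise: the ideal is homogeneous for the
  grading of the paths by the \<open>i\<close>-th group, and hence so are its minimal relations.
\<close>

section \<open>Words and quotient monoids\<close>

type_synonym word = "(nat \<times> bool) list"

lemma pres_eq_context: "pres_eq R u v \<Longrightarrow> pres_eq R (w @ u @ w') (w @ v @ w')"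
proof (induction rule: pres_eq.induct)
  case (pe_sym u v)
  then show ?case by (blast intro: pres_eq.pe_sym)
next
  case (pe_trans u v w)
  then show ?case by (blast intro: pres_eq.pe_trans)
next
  case (pe_cancel u x b v)
  show ?case using pres_eq.pe_cancel[of R "w @ u" x b "v @ w'"] by simp
next
  case (pe_rel r u v)
  show ?case using pres_eq.pe_rel[OF pe_rel, of "w @ u" "v @ w'"] by simp
qed (rule pe_refl)

lemma pres_eq_append: "pres_eq R u u' \<Longrightarrow> pres_eq R v v' \<Longrightarrow> pres_eq R (u @ v) (u' @ v')"
  using pres_eq_context[of R u u' "[]" v] pres_eq_context[of R v v' u' "[]"]
  by (auto intro: pe_trans)

text \<open>The steps of a walk form a word in the arrows, so this also serves as the inverse of a walk.\<close>

definition inv_word :: "word \<Rightarrow> word" where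
  "inv_word u = rev (map (\<lambda>(x, b). (x, \<not> b)) u)"

lemma inv_word_Nil [simp]: "inv_word [] = []"
  and inv_word_Cons [simp]: "inv_word ((x, b) # u) = inv_word u @ [(x, \<not> b)]"
  and inv_word_append [simp]: "inv_word (u @ v) = inv_word v @ inv_word u"
  by (simp_all add: inv_word_def)

lemma inv_word_inv_word [simp]: "inv_word (inv_word u) = u"
  by (simp add: inv_word_def rev_map case_prod_beta comp_def)

lemma inv_word_in_lists: "u \<in> lists (X \<times> UNIV) \<Longrightarrow> inv_word u \<in> lists (X \<times> UNIV)"
  by (auto simp: inv_word_def)

lemma pres_eq_right_inverse: "pres_eq R (u @ inv_word u) []"
proof (induction u rule: rev_induct)
  case (snoc l u)
  obtain x b where l: "l = (x, b)" by (cases l)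
  have "pres_eq R (u @ [(x, b), (x, \<not> b)] @ inv_word u) (u @ inv_word u)" by (rule pe_cancel)
  then show ?case using snoc by (auto simp: l intro: pe_trans)
qed (simp add: pe_refl)

lemma pres_eq_left_inverse: "pres_eq R (inv_word u @ u) []"
  using pres_eq_right_inverse[of R "inv_word u"] by simp

definition word_hom :: "(nat \<Rightarrow> word) \<Rightarrow> word \<Rightarrow> word" where
  "word_hom h u = concat (map (\<lambda>(x, b). if b then h x else inv_word (h x)) u)"

lemma word_hom_Nil [simp]: "word_hom h [] = []"
  and word_hom_Cons [simp]:
    "word_hom h ((x, b) # u) = (if b then h x else inv_word (h x)) @ word_hom h u"
  and word_hom_append [simp]: "word_hom h (u @ v) = word_hom h u @ word_hom h v"
  by (simp_all add: word_hom_def)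

lemma word_hom_inv_word [simp]: "word_hom h (inv_word u) = inv_word (word_hom h u)"
  by (induction u) auto

lemma word_hom_in_lists:
  assumes "\<And>x b. (x, b) \<in> set u \<Longrightarrow> h x \<in> lists (X \<times> UNIV)"
  shows "word_hom h u \<in> lists (X \<times> UNIV)"
  using assms
proof (induction u)
  case (Cons l u)
  obtain x b where l: "l = (x, b)" by (cases l)
  have "h x \<in> lists (X \<times> UNIV)" by (rule Cons.prems[of x b]) (simp add: l)
  moreover have "word_hom h u \<in> lists (X \<times> UNIV)"
    by (rule Cons.IH) (rule Cons.prems, erule list.set_intros(2))
  ultimately show ?case
    using inv_word_in_lists[of "h x" X] by (simp add: l del: in_lists_conv_set)
qed simp

locale monoid_congruence =
  fixes R :: "'w \<Rightarrow> 'w \<Rightarrow> bool" and D :: "'w set" and app :: "'w \<Rightarrow> 'w \<Rightarrow> 'w"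
  assumes refl: "a \<in> D \<Longrightarrow> R a a"
    and sym: "R a b \<Longrightarrow> R b a"
    and trans: "R a b \<Longrightarrow> R b c \<Longrightarrow> R a c"
    and closed: "a \<in> D \<Longrightarrow> b \<in> D \<Longrightarrow> app a b \<in> D"
    and cong: "a \<in> D \<Longrightarrow> a' \<in> D \<Longrightarrow> b \<in> D \<Longrightarrow> b' \<in> D \<Longrightarrow> R a a' \<Longrightarrow> R b b' \<Longrightarrow>
      R (app a b) (app a' b')"
begin

definition eqclass :: "'w \<Rightarrow> 'w set" where
  "eqclass a = {b. R a b}"

definition rep :: "'w set \<Rightarrow> 'w" where
  "rep A = (SOME a. a \<in> A \<inter> D)"

lemma eqclass_eqI: "R a b \<Longrightarrow> eqclass a = eqclass b"
  unfolding eqclass_def using sym trans by blast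

lemma eqclass_eq_iff:
  assumes "a \<in> D" "b \<in> D"
  shows "eqclass a = eqclass b \<longleftrightarrow> R a b"
proof
  assume eq: "eqclass a = eqclass b"
  have "b \<in> eqclass b" using refl assms by (simp add: eqclass_def)
  then have "b \<in> eqclass a" by (simp only: eq)
  then show "R a b" by (simp add: eqclass_def)
qed (rule eqclass_eqI)

lemma rep_eqclass:
  assumes "a \<in> D"
  shows "rep (eqclass a) \<in> D" "R (rep (eqclass a)) a"
proof -
  have "a \<in> eqclass a \<inter> D" using refl assms by (simp add: eqclass_def)
  then have "rep (eqclass a) \<in> eqclass a \<inter> D" unfolding rep_def by (rule someI)
  then show "rep (eqclass a) \<in> D" "R (rep (eqclass a)) a"
    using sym by (auto simp: eqclass_def)
qed

lemma carrier_quot_monoid: "carrier (quot_monoid R D app e) = eqclass ` D"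
  by (simp add: quot_monoid_def eqclass_def)

lemma mult_eqclass:
  assumes "a \<in> D" "b \<in> D"
  shows "eqclass a \<otimes>\<^bsub>quot_monoid R D app e\<^esub> eqclass b = eqclass (app a b)"
proof -
  have "R (app (rep (eqclass a)) (rep (eqclass b))) (app a b)"
    using assms by (intro cong rep_eqclass)
  then show ?thesis
    using eqclass_eqI by (simp add: quot_monoid_def eqclass_def rep_def)
qed

end

lemma quot_monoid_iso:
  assumes R: "monoid_congruence R D app" and S: "monoid_congruence S E app'"
    and closed: "\<And>a. a \<in> D \<Longrightarrow> f a \<in> E"
    and iff: "\<And>a b. a \<in> D \<Longrightarrow> b \<in> D \<Longrightarrow> R a b \<longleftrightarrow> S (f a) (f b)"
    and hom: "\<And>a b. a \<in> D \<Longrightarrow> b \<in> D \<Longrightarrow> f (app a b) = app' (f a) (f b)"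
    and surj: "\<And>b. b \<in> E \<Longrightarrow> \<exists>a\<in>D. S (f a) b"
  shows "quot_monoid R D app e \<cong> quot_monoid S E app' e'"
proof -
  interpret R: monoid_congruence R D app by (rule R)
  interpret S: monoid_congruence S E app' by (rule S)
  let ?G = "quot_monoid R D app e" and ?H = "quot_monoid S E app' e'"
  define h where "h A = S.eqclass (f (R.rep A))" for A
  have h_eqclass: "h (R.eqclass a) = S.eqclass (f a)" if "a \<in> D" for a
    unfolding h_def using R.rep_eqclass[OF that] that iff by (intro S.eqclass_eqI) blast
  have "h \<in> hom ?G ?H"
  proof (rule homI)
    fix A B assume "A \<in> carrier ?G" "B \<in> carrier ?G"
    then obtain a b where ab: "a \<in> D" "b \<in> D" "A = R.eqclass a" "B = R.eqclass b"
      by (auto simp: R.carrier_quot_monoid)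
    then show "h (A \<otimes>\<^bsub>?G\<^esub> B) = h A \<otimes>\<^bsub>?H\<^esub> h B"
      by (simp add: R.mult_eqclass S.mult_eqclass R.closed closed h_eqclass hom)
  qed (auto simp: R.carrier_quot_monoid S.carrier_quot_monoid h_eqclass closed)
  moreover have "inj_on h (carrier ?G)"
    by (auto simp: inj_on_def R.carrier_quot_monoid h_eqclass closed
        R.eqclass_eq_iff S.eqclass_eq_iff iff)
  moreover have "h ` carrier ?G = carrier ?H"
  proof -
    have "S.eqclass b \<in> S.eqclass ` f ` D" if "b \<in> E" for b
      using surj[OF that] S.eqclass_eqI by blast
    then have "S.eqclass ` f ` D = S.eqclass ` E" using closed by blast
    moreover have "h ` carrier ?G = S.eqclass ` f ` D"
      by (simp add: R.carrier_quot_monoid image_image h_eqclass)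
    ultimately show ?thesis by (simp add: S.carrier_quot_monoid)
  qed
  ultimately show ?thesis by (intro is_isoI) (simp add: iso_def bij_betw_def)
qed

section \<open>Path algebras\<close>

lemma pa_add_conv_plus: "pa_add f g = f + g"
  and pa_diff_conv_minus: "pa_diff f g = f - g"
  and zero_path_fun: "(\<lambda>_. 0) = (0 :: path \<Rightarrow> 'k::field)"
  by (auto simp: pa_add_def pa_diff_def)

interpretation pa: vector_space "pa_smult :: 'k::field \<Rightarrow> _"
  by unfold_locales (auto simp: pa_smult_def algebra_simps)

interpretation pa_pair: vector_space_pair
    "pa_smult :: 'k::field \<Rightarrow> _" "pa_smult :: 'k \<Rightarrow> _" ..

abbreviation pa_linear :: "((path \<Rightarrow> 'k::field) \<Rightarrow> path \<Rightarrow> 'k) \<Rightarrow> bool" where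
  "pa_linear \<equiv> Vector_Spaces.linear pa_smult pa_smult"

lemma pa_linearI:
  "(\<And>f g. \<phi> (f + g) = \<phi> f + \<phi> g) \<Longrightarrow> (\<And>c f. \<phi> (pa_smult c f) = pa_smult c (\<phi> f)) \<Longrightarrow> pa_linear \<phi>"
  by (simp add: Vector_Spaces.linear_iff pa.vector_space_axioms)

lemma pa_linear_compose: "pa_linear \<phi> \<Longrightarrow> pa_linear \<psi> \<Longrightarrow> pa_linear (\<lambda>f. \<psi> (\<phi> f))"
  using Vector_Spaces.linear_compose[of pa_smult pa_smult \<phi> pa_smult \<psi>] by (simp add: comp_def)

lemma pa_linear_span_in_subspace:
  assumes "pa_linear \<phi>" "pa.subspace V" "\<And>f. f \<in> S \<Longrightarrow> \<phi> f \<in> V" "f \<in> pa.span S"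
  shows "\<phi> f \<in> V"
proof -
  have "pa.span S \<subseteq> {f. \<phi> f \<in> V}"
    using assms by (intro pa.span_minimal pa_pair.linear_subspace_linear_preimage) auto
  then show ?thesis using assms(4) by blast
qed

definition basis_elt :: "path \<Rightarrow> path \<Rightarrow> 'k::field" where
  "basis_elt p = (\<lambda>q. if q = p then 1 else 0)"

lemma inj_basis_elt: "inj (basis_elt :: path \<Rightarrow> path \<Rightarrow> 'k::field)"
  by (auto simp: inj_def basis_elt_def fun_eq_iff split: if_splits)

lemma arrow_elt_conv_basis_elt: "arrow_elt Q a = basis_elt (src Q a, [a])"
  by (simp add: arrow_elt_def basis_elt_def)

definition path_span :: "path set \<Rightarrow> (path \<Rightarrow> 'k::field) set" where
  "path_span P = pa.span (basis_elt ` P)"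

lemma subspace_path_span [simp]: "pa.subspace (path_span P)"
  by (simp add: path_span_def)

lemma basis_elt_in_path_span: "p \<in> P \<Longrightarrow> basis_elt p \<in> path_span P"
  by (simp add: path_span_def pa.span_base)

lemma path_span_mono: "P \<subseteq> P' \<Longrightarrow> path_span P \<subseteq> path_span P'"
  unfolding path_span_def by (intro pa.span_mono image_mono)

lemma pa_linear_path_span_in_subspace:
  assumes "pa_linear \<phi>" "pa.subspace V" "\<And>p. p \<in> P \<Longrightarrow> \<phi> (basis_elt p) \<in> V" "f \<in> path_span P"
  shows "\<phi> f \<in> V"
  by (rule pa_linear_span_in_subspace[of \<phi> V "basis_elt ` P"])
    (use assms in \<open>auto simp: path_span_def\<close>)

lemma pa_linear_eq_on_path_span:
  assumes "pa_linear \<phi>" "pa_linear \<psi>" "f \<in> path_span P"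
    and "\<And>p. p \<in> P \<Longrightarrow> \<phi> (basis_elt p) = \<psi> (basis_elt p)"
  shows "\<phi> f = \<psi> f"
  using assms unfolding path_span_def by (auto intro: pa_pair.linear_eq_on[of \<phi> \<psi>])

lemma sum_basis_elt:
  assumes "finite A" "{p. f p \<noteq> 0} \<subseteq> A"
  shows "(\<Sum>p\<in>A. pa_smult (f p) (basis_elt p)) = f"
proof
  fix q
  have "(\<Sum>p\<in>A. pa_smult (f p) (basis_elt p)) q = (\<Sum>p\<in>A. if q = p then f p else 0)"
    using assms(1) by (induction A) (auto simp: pa_smult_def basis_elt_def)
  then show "(\<Sum>p\<in>A. pa_smult (f p) (basis_elt p)) q = f q"
    using assms by auto
qed

lemma mem_path_span_iff: "f \<in> path_span P \<longleftrightarrow> finite {p. f p \<noteq> 0} \<and> (\<forall>p. f p \<noteq> 0 \<longrightarrow> p \<in> P)"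
proof
  assume "f \<in> path_span P"
  then show "finite {p. f p \<noteq> 0} \<and> (\<forall>p. f p \<noteq> 0 \<longrightarrow> p \<in> P)"
    unfolding path_span_def
  proof (induction rule: pa.span_induct_alt)
    case (step c b f)
    then obtain q where "q \<in> P" "b = basis_elt q" by auto
    moreover from this have "{p. (pa_smult c b + f) p \<noteq> 0} \<subseteq> insert q {p. f p \<noteq> 0}"
      by (auto simp: pa_smult_def basis_elt_def)
    ultimately show ?case
      using step.IH finite_subset[of _ "insert q {p. f p \<noteq> 0}"] by blast
  qed simp
next
  assume f: "finite {p. f p \<noteq> 0} \<and> (\<forall>p. f p \<noteq> 0 \<longrightarrow> p \<in> P)"
  then have "(\<Sum>p | f p \<noteq> 0. pa_smult (f p) (basis_elt p)) \<in> path_span P"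
    by (intro pa.subspace_sum pa.subspace_scale subspace_path_span basis_elt_in_path_span) auto
  then show "f \<in> path_span P" using f by (simp add: sum_basis_elt)
qed

lemma path_span_Int: "f \<in> path_span P \<Longrightarrow> f \<in> path_span P' \<Longrightarrow> f \<in> path_span (P \<inter> P')"
  by (simp add: mem_path_span_iff)

lemma sum_basis_elt_apply: "finite P \<Longrightarrow> (\<Sum>p\<in>P. basis_elt q p) = of_bool (q \<in> P)"
  by (simp add: basis_elt_def)

lemma path_alg_conv_path_span: "path_alg Q = path_span {p. is_path Q p}"
  by (auto simp: path_alg_def mem_path_span_iff)

lemma subspace_path_alg [simp]: "pa.subspace (path_alg Q)"
  by (simp add: path_alg_conv_path_span)

lemma basis_elt_in_path_alg: "is_path Q p \<Longrightarrow> basis_elt p \<in> path_alg Q"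
  by (simp add: path_alg_conv_path_span basis_elt_in_path_span)

lemma pa_linear_eq_on_path_alg:
  assumes "pa_linear \<phi>" "pa_linear \<psi>" "f \<in> path_alg Q"
    and "\<And>p. is_path Q p \<Longrightarrow> \<phi> (basis_elt p) = \<psi> (basis_elt p)"
  shows "\<phi> f = \<psi> f"
  using assms by (auto simp: path_alg_conv_path_span intro: pa_linear_eq_on_path_span[of \<phi> \<psi>])

lemma independent_basis_elts: "pa.independent (range (basis_elt :: path \<Rightarrow> path \<Rightarrow> 'k::field))"
  unfolding pa.dependent_def
proof
  assume "\<exists>b\<in>range basis_elt. b \<in> pa.span (range basis_elt - {b :: path \<Rightarrow> 'k})"
  then obtain p where "(basis_elt p :: path \<Rightarrow> 'k) \<in> pa.span (range basis_elt - {basis_elt p})"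
    by auto
  also have "range basis_elt - {basis_elt p} = basis_elt ` (- {p} :: path set)"
    using inj_basis_elt by (auto dest: injD)
  finally have "(basis_elt p :: path \<Rightarrow> 'k) \<in> path_span (- {p})" by (simp add: path_span_def)
  then have "basis_elt p p \<noteq> (0::'k) \<longrightarrow> p \<in> - {p}" by (auto simp only: mem_path_span_iff)
  then show False by (simp add: basis_elt_def)
qed

definition linear_extension :: "(path \<Rightarrow> path \<Rightarrow> 'k::field) \<Rightarrow> (path \<Rightarrow> 'k) \<Rightarrow> path \<Rightarrow> 'k" where
  "linear_extension g = pa_pair.construct (range basis_elt) (\<lambda>b. g (inv_into UNIV basis_elt b))"

lemma linear_linear_extension: "pa_linear (linear_extension g)"
  unfolding linear_extension_def by (rule pa_pair.linear_construct[OF independent_basis_elts])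

lemma linear_extension_basis_elt [simp]: "linear_extension g (basis_elt p) = g p"
  by (simp add: linear_extension_def pa_pair.construct_basis independent_basis_elts inj_basis_elt)

section \<open>Multiplication in the path algebra\<close>

lemma linear_pa_mult_right: "pa_linear (pa_mult Q f)"
  by (rule pa_linearI)
    (auto simp: pa_mult_def pa_smult_def fun_eq_iff sum.distrib sum_distrib_left algebra_simps)

lemma linear_pa_mult_left: "pa_linear (\<lambda>f. pa_mult Q f g)"
  by (rule pa_linearI)
    (auto simp: pa_mult_def pa_smult_def fun_eq_iff sum.distrib sum_distrib_left algebra_simps)

lemmas pa_mult_0_right [simp] = pa_pair.linear_0[OF linear_pa_mult_right]
  and pa_mult_diff_right = pa_pair.linear_diff[OF linear_pa_mult_right]
  and pa_mult_0_left [simp] = pa_pair.linear_0[OF linear_pa_mult_left]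
  and pa_mult_diff_left = pa_pair.linear_diff[OF linear_pa_mult_left]

lemma pa_mult_in_subspace:
  assumes V: "pa.subspace V" and "f \<in> path_span A" "g \<in> path_span B"
    and AB: "\<And>p q. p \<in> A \<Longrightarrow> q \<in> B \<Longrightarrow> pa_mult Q (basis_elt p) (basis_elt q) \<in> V"
  shows "pa_mult Q f g \<in> V"
proof -
  have "pa_mult Q (basis_elt p) g \<in> V" if "p \<in> A" for p
    using AB[OF that] by (rule pa_linear_path_span_in_subspace[OF linear_pa_mult_right V _ assms(3)])
  then show ?thesis by (rule pa_linear_path_span_in_subspace[OF linear_pa_mult_left V _ assms(2)])
qed

lemma walk_end_Some_start: "walk_end Q x s = Some y \<Longrightarrow> x \<in> verts Q"
  by (cases s) (auto split: if_splits)

lemma walk_end_append: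
  "walk_end Q x (s @ t) = (case walk_end Q x s of None \<Rightarrow> None | Some y \<Rightarrow> walk_end Q y t)"
proof (induction s arbitrary: x)
  case Nil
  show ?case by (cases t) auto
next
  case (Cons e s)
  then show ?case by (cases e) auto
qed

lemma is_path_Nil [simp]: "is_path Q (x, []) \<longleftrightarrow> x \<in> verts Q"
  by (simp add: is_path_def fwd_def)

lemma is_path_Cons: "is_path Q (x, a # as) \<longleftrightarrow>
    x \<in> verts Q \<and> a \<in> arrs Q \<and> src Q a = x \<and> is_path Q (tgt Q a, as)"
  by (auto simp: is_path_def fwd_def)

lemma path_end_Nil [simp]: "x \<in> verts Q \<Longrightarrow> path_end Q (x, []) = x"
  by (simp add: path_end_def fwd_def)

lemma path_end_Cons: "is_path Q (x, a # as) \<Longrightarrow> path_end Q (x, a # as) = path_end Q (tgt Q a, as)"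
  by (simp add: is_path_Cons path_end_def fwd_def)

lemma is_path_append:
  "is_path Q (x, as @ bs) \<longleftrightarrow> is_path Q (x, as) \<and> is_path Q (path_end Q (x, as), bs)"
  by (auto simp: is_path_def path_end_def fwd_def walk_end_append split: option.splits)

lemma path_end_append:
  "is_path Q (x, as) \<Longrightarrow> path_end Q (x, as @ bs) = path_end Q (path_end Q (x, as), bs)"
  by (auto simp: is_path_def path_end_def fwd_def walk_end_append)

lemma is_path_verts: "is_path Q (x, as) \<Longrightarrow> x \<in> verts Q"
  by (auto simp: is_path_def dest: walk_end_Some_start)

lemma height_path_end:
  assumes height: "\<And>a. a \<in> arrs Q \<Longrightarrow> h (tgt Q a) = Suc (h (src Q a))"
  shows "is_path Q (x, as) \<Longrightarrow> h (path_end Q (x, as)) = h x + length as"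
  by (induction as arbitrary: x) (auto simp: is_path_Cons path_end_Cons height)

lemma pa_mult_basis_elt:
  "pa_mult Q (basis_elt (x, as)) (basis_elt (y, bs)) =
    (if is_path Q (x, as @ bs) \<and> path_end Q (x, as) = y then basis_elt (x, as @ bs) else 0)"
proof
  fix p :: path
  obtain z cs where p: "p = (z, cs)" by (cases p)
  let ?composable = "z = x \<and> cs = as @ bs \<and> path_end Q (x, as) = y"
  have summand: "basis_elt (x, as) (z, take i cs) *
      basis_elt (y, bs) (path_end Q (z, take i cs), drop i cs) =
      (if i = length as then of_bool ?composable else 0)" if "i \<le> length cs" for i
  proof -
    have "take i cs = as \<and> drop i cs = bs \<longleftrightarrow> i = length as \<and> cs = as @ bs"
      using that by (metis append_eq_conv_conj length_take min.absorb2)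
    moreover have "basis_elt (x, as) (z, take i cs) *
        basis_elt (y, bs) (path_end Q (z, take i cs), drop i cs) =
        of_bool (z = x \<and> path_end Q (x, as) = y \<and> take i cs = as \<and> drop i cs = bs)"
      by (auto simp: basis_elt_def)
    ultimately show ?thesis by auto
  qed
  have "(\<Sum>i = 0..length cs. basis_elt (x, as) (z, take i cs) *
      basis_elt (y, bs) (path_end Q (z, take i cs), drop i cs)) =
      (\<Sum>i = 0..length cs. if i = length as then of_bool ?composable else 0)"
    by (intro sum.cong refl summand) simp
  also have "\<dots> = of_bool ?composable" by auto
  finally show "pa_mult Q (basis_elt (x, as)) (basis_elt (y, bs)) p =
      (if is_path Q (x, as @ bs) \<and> path_end Q (x, as) = y then basis_elt (x, as @ bs) else 0) p"
    by (auto simp: p pa_mult_def basis_elt_def)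
qed

lemma pa_mult_assoc:
  assumes f: "f \<in> path_alg Q" and g: "g \<in> path_alg Q" and h: "h \<in> path_alg Q"
  shows "pa_mult Q (pa_mult Q f g) h = pa_mult Q f (pa_mult Q g h)"
proof -
  note linear = linear_pa_mult_left linear_pa_mult_right
    pa_linear_compose[OF linear_pa_mult_left linear_pa_mult_left]
    pa_linear_compose[OF linear_pa_mult_left linear_pa_mult_right]
    pa_linear_compose[OF linear_pa_mult_right linear_pa_mult_left]
    pa_linear_compose[OF linear_pa_mult_right linear_pa_mult_right]
  show ?thesis
  proof (rule pa_linear_eq_on_path_alg[OF _ _ f])
    fix p :: path
    show "pa_mult Q (pa_mult Q (basis_elt p) g) h = pa_mult Q (basis_elt p) (pa_mult Q g h)"
    proof (rule pa_linear_eq_on_path_alg[OF _ _ g])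
      fix q :: path
      show "pa_mult Q (pa_mult Q (basis_elt p) (basis_elt q)) h =
          pa_mult Q (basis_elt p) (pa_mult Q (basis_elt q) h)"
      proof (rule pa_linear_eq_on_path_alg[OF _ _ h])
        fix r :: path
        obtain x as y bs z cs where "p = (x, as)" "q = (y, bs)" "r = (z, cs)"
          by (cases p, cases q, cases r)
        then show "pa_mult Q (pa_mult Q (basis_elt p) (basis_elt q)) (basis_elt r) =
            pa_mult Q (basis_elt p) (pa_mult Q (basis_elt q) (basis_elt r))"
          by (auto simp: pa_mult_basis_elt is_path_append path_end_append)
      qed (intro linear)+
    qed (intro linear)+
  qed (intro linear)+
qed

lemma pa_mult_in_path_alg: "f \<in> path_alg Q \<Longrightarrow> g \<in> path_alg Q \<Longrightarrow> pa_mult Q f g \<in> path_alg Q"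
  unfolding path_alg_conv_path_span
proof (rule pa_mult_in_subspace[OF subspace_path_span])
  fix p q :: path
  obtain x as y bs where "p = (x, as)" "q = (y, bs)" by (cases p, cases q)
  then show "pa_mult Q (basis_elt p) (basis_elt q) \<in> path_span {p. is_path Q p}"
    by (auto simp: pa_mult_basis_elt pa.subspace_0 intro: basis_elt_in_path_span)
qed

definition paths_between :: "quiver \<Rightarrow> nat \<Rightarrow> nat \<Rightarrow> path set" where
  "paths_between Q x y = {p. is_path Q p \<and> fst p = x \<and> path_end Q p = y}"

lemma mem_paths_between [simp]:
  "(z, as) \<in> paths_between Q x y \<longleftrightarrow> z = x \<and> is_path Q (x, as) \<and> path_end Q (x, as) = y"
  by (auto simp: paths_between_def)

lemma path_span_paths_between_subset: "path_span (paths_between Q x y) \<subseteq> path_alg Q"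
  unfolding path_alg_conv_path_span by (rule path_span_mono) (auto simp: paths_between_def)

lemma pa_mult_paths_between:
  assumes "f \<in> path_span (paths_between Q x y)" "g \<in> path_span (paths_between Q y z)"
  shows "pa_mult Q f g \<in> path_span (paths_between Q x z)"
proof (rule pa_mult_in_subspace[OF subspace_path_span assms])
  fix p q assume "p \<in> paths_between Q x y" "q \<in> paths_between Q y z"
  moreover obtain as bs where "p = (fst p, as)" "q = (fst q, bs)" by (metis prod.collapse)
  ultimately show "pa_mult Q (basis_elt p) (basis_elt q) \<in> path_span (paths_between Q x z)"
    by (cases p, cases q)
      (auto simp: pa_mult_basis_elt is_path_append path_end_append intro: basis_elt_in_path_span)
qed

lemma pa_mult_vertex_left:
  assumes "f \<in> path_span (paths_between Q x y)"
  shows "pa_mult Q (basis_elt (x, [])) f = f"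
proof (rule pa_linear_eq_on_path_span[OF linear_pa_mult_right pa.linear_ident assms])
  fix p assume "p \<in> paths_between Q x y"
  then show "pa_mult Q (basis_elt (x, [])) (basis_elt p) = basis_elt p"
    using is_path_verts by (cases p) (auto simp: pa_mult_basis_elt)
qed

lemma pa_mult_vertex_right:
  assumes "f \<in> path_span (paths_between Q x y)"
  shows "pa_mult Q f (basis_elt (y, [])) = f"
proof (rule pa_linear_eq_on_path_span[OF linear_pa_mult_left pa.linear_ident assms])
  fix p assume "p \<in> paths_between Q x y"
  then show "pa_mult Q (basis_elt p) (basis_elt (y, [])) = basis_elt p"
    by (cases p) (auto simp: pa_mult_basis_elt)
qed

lemma pa_mult_not_composable:
  assumes "f \<in> path_span (paths_between Q x y)" "g \<in> path_span (paths_between Q y' z)" "y \<noteq> y'"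
  shows "pa_mult Q f g = 0"
proof -
  have "pa_mult Q f g \<in> {0}"
  proof (rule pa_mult_in_subspace[OF _ assms(1,2)])
    fix p q assume "p \<in> paths_between Q x y" "q \<in> paths_between Q y' z"
    then show "pa_mult Q (basis_elt p) (basis_elt q) \<in> {0}"
      using assms(3) by (cases p, cases q) (auto simp: pa_mult_basis_elt)
  qed simp
  then show ?thesis by simp
qed

lemma pa_one_conv_sum: "finite (verts Q) \<Longrightarrow> pa_one Q = (\<Sum>x\<in>verts Q. basis_elt (x, []))"
proof
  fix p assume "finite (verts Q)"
  moreover have "(\<Sum>x\<in>A. basis_elt (x, [])) p =
      (\<Sum>x\<in>A. if x = fst p then of_bool (snd p = []) else (0::'a))" if "finite A" for A
    using that by (induction A) (auto simp: basis_elt_def prod_eq_iff)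
  ultimately show "pa_one Q p = (\<Sum>x\<in>verts Q. basis_elt (x, []) :: path \<Rightarrow> 'a) p"
    by (simp add: pa_one_def)
qed

section \<open>Substitution of arrows\<close>

fun path_image :: "quiver \<Rightarrow> (nat \<Rightarrow> path \<Rightarrow> 'k::field) \<Rightarrow> path \<Rightarrow> path \<Rightarrow> 'k" where
  "path_image Q \<theta> (x, []) = basis_elt (x, [])"
| "path_image Q \<theta> (x, a # as) = pa_mult Q (\<theta> a) (path_image Q \<theta> (tgt Q a, as))"

definition arrow_subst :: "quiver \<Rightarrow> (nat \<Rightarrow> path \<Rightarrow> 'k::field) \<Rightarrow> (path \<Rightarrow> 'k) \<Rightarrow> path \<Rightarrow> 'k" where
  "arrow_subst Q \<theta> = linear_extension (path_image Q \<theta>)"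

lemma linear_arrow_subst: "pa_linear (arrow_subst Q \<theta>)"
  unfolding arrow_subst_def by (rule linear_linear_extension)

lemma arrow_subst_Nil [simp]: "arrow_subst Q \<theta> (basis_elt (x, [])) = basis_elt (x, [])"
  and arrow_subst_Cons [simp]: "arrow_subst Q \<theta> (basis_elt (x, a # as)) =
    pa_mult Q (\<theta> a) (arrow_subst Q \<theta> (basis_elt (tgt Q a, as)))"
  by (simp_all add: arrow_subst_def)

locale arrow_substitution =
  fixes Q :: quiver and \<theta> :: "nat \<Rightarrow> path \<Rightarrow> 'k::field"
  assumes finite_Q: "finite_quiver Q"
    and arrow_image: "a \<in> arrs Q \<Longrightarrow> \<theta> a \<in> path_span (paths_between Q (src Q a) (tgt Q a))"
begin

lemma subst_basis_elt:
  "is_path Q (x, as) \<Longrightarrow>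
    arrow_subst Q \<theta> (basis_elt (x, as)) \<in> path_span (paths_between Q x (path_end Q (x, as)))"
proof (induction as arbitrary: x)
  case (Cons a as)
  then show ?case
    using pa_mult_paths_between[OF arrow_image] by (auto simp: is_path_Cons path_end_Cons)
qed (simp add: basis_elt_in_path_span)

lemma subst_arrow_elt: "a \<in> arrs Q \<Longrightarrow> arrow_subst Q \<theta> (arrow_elt Q a) = \<theta> a"
  by (simp add: arrow_elt_conv_basis_elt pa_mult_vertex_right[OF arrow_image])

lemma subst_in_path_alg:
  assumes "f \<in> path_alg Q"
  shows "arrow_subst Q \<theta> f \<in> path_alg Q"
proof (rule pa_linear_path_span_in_subspace[OF linear_arrow_subst subspace_path_alg])
  show "f \<in> path_span {p. is_path Q p}" using assms by (simp add: path_alg_conv_path_span)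
  fix p assume "p \<in> {p. is_path Q p}"
  then show "arrow_subst Q \<theta> (basis_elt p) \<in> path_alg Q"
    using subst_basis_elt path_span_paths_between_subset by (cases p) blast
qed

lemma subst_append:
  "is_path Q (x, as @ bs) \<Longrightarrow> arrow_subst Q \<theta> (basis_elt (x, as @ bs)) =
    pa_mult Q (arrow_subst Q \<theta> (basis_elt (x, as)))
      (arrow_subst Q \<theta> (basis_elt (path_end Q (x, as), bs)))"
proof (induction as arbitrary: x)
  case Nil
  then show ?case using is_path_verts pa_mult_vertex_left[OF subst_basis_elt] by simp
next
  case (Cons a as)
  then have paths: "a \<in> arrs Q" "is_path Q (x, a # as)" "is_path Q (tgt Q a, as @ bs)"
    by (auto simp: is_path_append is_path_Cons path_end_Cons)
  then have "\<theta> a \<in> path_alg Q" using arrow_image path_span_paths_between_subset by blast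
  moreover have "arrow_subst Q \<theta> (basis_elt (tgt Q a, as)) \<in> path_alg Q"
      "arrow_subst Q \<theta> (basis_elt (path_end Q (tgt Q a, as), bs)) \<in> path_alg Q"
    using paths(3) by (auto simp: is_path_append intro: subst_in_path_alg basis_elt_in_path_alg)
  ultimately show ?case
    using paths by (simp add: Cons.IH pa_mult_assoc path_end_Cons)
qed

lemma subst_mult:
  assumes f: "f \<in> path_alg Q" and g: "g \<in> path_alg Q"
  shows "arrow_subst Q \<theta> (pa_mult Q f g) = pa_mult Q (arrow_subst Q \<theta> f) (arrow_subst Q \<theta> g)"
proof -
  note linear =
    pa_linear_compose[OF linear_arrow_subst linear_pa_mult_left]
    pa_linear_compose[OF linear_arrow_subst linear_pa_mult_right]
    pa_linear_compose[OF linear_pa_mult_left linear_arrow_subst]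
    pa_linear_compose[OF linear_pa_mult_right linear_arrow_subst]
  show ?thesis
  proof (rule pa_linear_eq_on_path_alg[OF _ _ f])
    fix p :: path assume p: "is_path Q p"
    show "arrow_subst Q \<theta> (pa_mult Q (basis_elt p) g) =
        pa_mult Q (arrow_subst Q \<theta> (basis_elt p)) (arrow_subst Q \<theta> g)"
    proof (rule pa_linear_eq_on_path_alg[OF _ _ g])
      fix q :: path assume q: "is_path Q q"
      obtain x as y bs where pq: "p = (x, as)" "q = (y, bs)" by (cases p, cases q)
      then show "arrow_subst Q \<theta> (pa_mult Q (basis_elt p) (basis_elt q)) =
          pa_mult Q (arrow_subst Q \<theta> (basis_elt p)) (arrow_subst Q \<theta> (basis_elt q))"
        using p q pa_mult_not_composable[OF subst_basis_elt subst_basis_elt, of x as y bs]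
        by (auto simp: pa_mult_basis_elt is_path_append subst_append
            pa_pair.linear_0[OF linear_arrow_subst])
    qed (rule linear)+
  qed (rule linear)+
qed

lemma subst_one: "arrow_subst Q \<theta> (pa_one Q) = pa_one Q"
  using finite_Q
  by (simp add: finite_quiver_def pa_one_conv_sum pa_pair.linear_sum[OF linear_arrow_subst])

end

lemma arrow_subst_arrow_subst:
  assumes "arrow_substitution Q \<theta>" "arrow_substitution Q \<eta>" and f: "f \<in> path_alg Q"
    and inverse: "\<And>a. a \<in> arrs Q \<Longrightarrow> arrow_subst Q \<theta> (\<eta> a) = arrow_elt Q a"
  shows "arrow_subst Q \<theta> (arrow_subst Q \<eta> f) = f"
proof -
  interpret \<theta>: arrow_substitution Q \<theta> by fact
  interpret \<eta>: arrow_substitution Q \<eta> by fact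
  show ?thesis
  proof (rule pa_linear_eq_on_path_alg[OF _ pa.linear_ident f])
    show "pa_linear (\<lambda>f. arrow_subst Q \<theta> (arrow_subst Q \<eta> f))"
      by (rule pa_linear_compose[OF linear_arrow_subst linear_arrow_subst])
    show "arrow_subst Q \<theta> (arrow_subst Q \<eta> (basis_elt p)) = basis_elt p" if "is_path Q p" for p
      using that
    proof (induction "snd p" arbitrary: p)
      case Nil
      then show ?case by (cases p) simp
    next
      case (Cons a as)
      then obtain x where p: "p = (x, a # as)" by (cases p) simp
      with Cons.prems have path: "a \<in> arrs Q" "src Q a = x" "is_path Q (tgt Q a, as)"
        by (auto simp: is_path_Cons)
      have "\<eta> a \<in> path_alg Q"
        using path_span_paths_between_subset \<eta>.arrow_image[OF path(1)] by blast
      moreover have "arrow_subst Q \<eta> (basis_elt (tgt Q a, as)) \<in> path_alg Q"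
        using path(3) by (intro \<eta>.subst_in_path_alg basis_elt_in_path_alg)
      ultimately have "arrow_subst Q \<theta> (arrow_subst Q \<eta> (basis_elt p)) =
          pa_mult Q (basis_elt (x, [a])) (basis_elt (tgt Q a, as))"
        using path Cons.hyps(1)[of "(tgt Q a, as)"]
        by (simp add: p \<theta>.subst_mult inverse arrow_elt_conv_basis_elt)
      then show ?case
        using Cons.prems is_path_verts[OF path(3)]
        by (simp add: p pa_mult_basis_elt path_end_Cons is_path_Cons)
    qed
  qed
qed

section \<open>Automorphisms of the path algebra\<close>

lemma pa_one_in_path_alg: "finite_quiver Q \<Longrightarrow> pa_one Q \<in> path_alg Q"
  by (auto simp: finite_quiver_def pa_one_conv_sum intro!: pa.subspace_sum basis_elt_in_path_alg)

lemma pa_ideal_iff: "pa_ideal Q I \<longleftrightarrow> I \<subseteq> path_alg Q \<and> pa.subspace I \<and>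
    (\<forall>f\<in>I. \<forall>g\<in>path_alg Q. pa_mult Q g f \<in> I \<and> pa_mult Q f g \<in> I)"
  unfolding pa_ideal_def pa.subspace_def pa_add_conv_plus zero_path_fun by blast

locale pa_automorphism =
  fixes Q :: quiver and \<phi> :: "(path \<Rightarrow> 'k::field) \<Rightarrow> path \<Rightarrow> 'k"
  assumes finite_Q: "finite_quiver Q"
    and bij: "bij_betw \<phi> (path_alg Q) (path_alg Q)"
    and add: "f \<in> path_alg Q \<Longrightarrow> g \<in> path_alg Q \<Longrightarrow> \<phi> (f + g) = \<phi> f + \<phi> g"
    and smult: "f \<in> path_alg Q \<Longrightarrow> \<phi> (pa_smult c f) = pa_smult c (\<phi> f)"
    and mult: "f \<in> path_alg Q \<Longrightarrow> g \<in> path_alg Q \<Longrightarrow> \<phi> (pa_mult Q f g) = pa_mult Q (\<phi> f) (\<phi> g)"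
    and one: "\<phi> (pa_one Q) = pa_one Q"
begin

lemma image_path_alg: "\<phi> ` path_alg Q = path_alg Q"
  using bij by (rule bij_betw_imp_surj_on)

lemma closed: "f \<in> path_alg Q \<Longrightarrow> \<phi> f \<in> path_alg Q"
  using image_path_alg by blast

lemma inj: "inj_on \<phi> (path_alg Q)"
  using bij by (rule bij_betw_imp_inj_on)

lemma zero: "\<phi> 0 = 0"
  using smult[of 0 0] by (simp add: pa.subspace_0)

lemma diff: "f \<in> path_alg Q \<Longrightarrow> g \<in> path_alg Q \<Longrightarrow> \<phi> (f - g) = \<phi> f - \<phi> g"
  using add[of "f - g" g] by (simp add: pa.subspace_diff)

lemma pa_automorphism_inv_into: "pa_automorphism Q (inv_into (path_alg Q) \<phi>)"
proof
  let ?inv = "inv_into (path_alg Q) \<phi>"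
  note inverse = f_inv_into_f[where f = \<phi> and A = "path_alg Q", unfolded image_path_alg]
    inv_into_into[where f = \<phi> and A = "path_alg Q", unfolded image_path_alg]
  show "finite_quiver Q" by (rule finite_Q)
  show "bij_betw ?inv (path_alg Q) (path_alg Q)" using bij by (rule bij_betw_inv_into)
  show "?inv (pa_one Q) = pa_one Q"
    by (intro inv_into_f_eq[OF inj] one pa_one_in_path_alg finite_Q)
  show "?inv (pa_smult c f) = pa_smult c (?inv f)" if "f \<in> path_alg Q" for c f
    using that by (intro inv_into_f_eq[OF inj]) (simp_all add: smult inverse pa.subspace_scale)
  show "?inv (f + g) = ?inv f + ?inv g" "?inv (pa_mult Q f g) = pa_mult Q (?inv f) (?inv g)"
    if "f \<in> path_alg Q" "g \<in> path_alg Q" for f g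
    using that by (auto intro!: inv_into_f_eq[OF inj] pa_mult_in_path_alg
        simp: add mult inverse pa.subspace_add)
qed

lemma pa_ideal_image:
  assumes I: "pa_ideal Q I"
  shows "pa_ideal Q (\<phi> ` I)"
  unfolding pa_ideal_iff
proof (intro conjI ballI)
  have sub: "f \<in> path_alg Q" if "f \<in> I" for f using I that by (auto simp: pa_ideal_iff)
  then show "\<phi> ` I \<subseteq> path_alg Q" using closed by blast
  have I_subspace: "pa.subspace I" using I by (simp add: pa_ideal_iff)
  show "pa.subspace (\<phi> ` I)"
  proof (rule pa.subspaceI)
    show "0 \<in> \<phi> ` I" using pa.subspace_0[OF I_subspace] zero by force
    show "f + g \<in> \<phi> ` I" if "f \<in> \<phi> ` I" "g \<in> \<phi> ` I" for f g
      using that sub pa.subspace_add[OF I_subspace] by (auto simp flip: add)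
    show "pa_smult c f \<in> \<phi> ` I" if "f \<in> \<phi> ` I" for c f
      using that sub pa.subspace_scale[OF I_subspace] by (auto simp flip: smult)
  qed
  fix f g :: "path \<Rightarrow> 'k" assume "f \<in> \<phi> ` I" "g \<in> path_alg Q"
  then obtain f' g' where pre: "f' \<in> I" "f = \<phi> f'" "g' \<in> path_alg Q" "g = \<phi> g'"
    using image_path_alg by blast
  then have "pa_mult Q g' f' \<in> I" "pa_mult Q f' g' \<in> I" using I by (auto simp: pa_ideal_iff)
  then show "pa_mult Q g f \<in> \<phi> ` I" "pa_mult Q f g \<in> \<phi> ` I"
    using pre sub by (auto simp flip: mult)
qed

lemma quotients_iso_image:
  assumes I: "pa_ideal Q I"
  shows "quotients_iso Q I (\<phi> ` I)"
  unfolding quotients_iso_def pa_add_conv_plus pa_diff_conv_minus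
proof (intro exI[of _ \<phi>] conjI ballI allI)
  have "0 \<in> I" using I by (simp add: pa_ideal_iff pa.subspace_0)
  then have zero_mem: "h - h \<in> \<phi> ` I" for h using zero by force
  have sub: "I \<subseteq> path_alg Q" using I by (simp add: pa_ideal_iff)
  fix f :: "path \<Rightarrow> 'k" assume f: "f \<in> path_alg Q"
  show "\<phi> f \<in> path_alg Q" using f by (rule closed)
  show "\<phi> (pa_smult c f) - pa_smult c (\<phi> f) \<in> \<phi> ` I" for c using f zero_mem by (simp add: smult)
  show "\<exists>g\<in>path_alg Q. \<phi> g - f \<in> \<phi> ` I" using f zero_mem image_path_alg by (metis imageE)
  fix g :: "path \<Rightarrow> 'k" assume g: "g \<in> path_alg Q"
  show "f - g \<in> I \<longleftrightarrow> \<phi> f - \<phi> g \<in> \<phi> ` I"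
    using f g sub inj by (simp add: inj_on_image_mem_iff pa.subspace_diff flip: diff)
  show "\<phi> (f + g) - (\<phi> f + \<phi> g) \<in> \<phi> ` I" using f g zero_mem by (simp add: add)
  show "\<phi> (pa_mult Q f g) - pa_mult Q (\<phi> f) (\<phi> g) \<in> \<phi> ` I" using f g zero_mem by (simp add: mult)
next
  show "\<phi> (pa_one Q) - pa_one Q \<in> \<phi> ` I"
    using I zero by (force simp: one pa_ideal_iff dest: pa.subspace_0)
qed

end

lemma pa_automorphism_compose:
  assumes "pa_automorphism Q \<phi>" "pa_automorphism Q \<psi>"
  shows "pa_automorphism Q (\<psi> \<circ> \<phi>)"
proof -
  interpret \<phi>: pa_automorphism Q \<phi> by fact
  interpret \<psi>: pa_automorphism Q \<psi> by fact
  show ?thesis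
  proof
    show "bij_betw (\<psi> \<circ> \<phi>) (path_alg Q) (path_alg Q)" using \<phi>.bij \<psi>.bij by (rule bij_betw_trans)
  qed (simp_all add: \<phi>.finite_Q \<phi>.closed \<phi>.add \<phi>.smult \<phi>.mult \<phi>.one \<psi>.add \<psi>.smult \<psi>.mult \<psi>.one)
qed

lemma quotients_iso_automorphic_images:
  assumes I: "pa_ideal Q I" and "pa_automorphism Q \<phi>" "pa_automorphism Q \<psi>"
  shows "quotients_iso Q (\<phi> ` I) (\<psi> ` I)"
proof -
  interpret \<phi>: pa_automorphism Q \<phi> by fact
  let ?\<chi> = "\<psi> \<circ> inv_into (path_alg Q) \<phi>"
  have "I \<subseteq> path_alg Q" using I by (simp add: pa_ideal_iff)
  then have "?\<chi> ` \<phi> ` I = \<psi> ` I"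
    by (auto simp: image_image subset_eq inv_into_f_f[OF \<phi>.inj] intro!: image_cong)
  moreover have "pa_automorphism Q ?\<chi>"
    by (rule pa_automorphism_compose[OF \<phi>.pa_automorphism_inv_into]) fact
  ultimately show ?thesis
    using pa_automorphism.quotients_iso_image \<phi>.pa_ideal_image[OF I] by metis
qed

lemma pa_automorphism_arrow_subst:
  assumes "arrow_substitution Q \<theta>" "arrow_substitution Q \<eta>"
    and "\<And>a. a \<in> arrs Q \<Longrightarrow> arrow_subst Q \<theta> (\<eta> a) = arrow_elt Q a"
    and "\<And>a. a \<in> arrs Q \<Longrightarrow> arrow_subst Q \<eta> (\<theta> a) = arrow_elt Q a"
  shows "pa_automorphism Q (arrow_subst Q \<theta>)"
proof -
  interpret \<theta>: arrow_substitution Q \<theta> by fact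
  interpret \<eta>: arrow_substitution Q \<eta> by fact
  show ?thesis
  proof
    show "bij_betw (arrow_subst Q \<theta>) (path_alg Q) (path_alg Q)"
      by (rule bij_betw_byWitness[where f' = "arrow_subst Q \<eta>"])
        (auto simp: arrow_subst_arrow_subst assms \<theta>.subst_in_path_alg \<eta>.subst_in_path_alg)
  qed (simp_all add: \<theta>.finite_Q \<theta>.subst_mult \<theta>.subst_one
      pa_pair.linear_add[OF linear_arrow_subst] pa_pair.linear_scale[OF linear_arrow_subst])
qed

section \<open>Shears along parallel arrows\<close>

locale parallel_arrows =
  fixes Q :: quiver and base :: "nat \<Rightarrow> nat"
  assumes finite_Q: "finite_quiver Q"
    and base_arrow: "a \<in> arrs Q \<Longrightarrow> base a \<in> arrs Q"
    and src_base: "a \<in> arrs Q \<Longrightarrow> src Q (base a) = src Q a"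
    and tgt_base: "a \<in> arrs Q \<Longrightarrow> tgt Q (base a) = tgt Q a"
begin

definition shear :: "(nat \<Rightarrow> 'k::field) \<Rightarrow> nat \<Rightarrow> path \<Rightarrow> 'k" where
  "shear c a = arrow_elt Q a + pa_smult (c a) (arrow_elt Q (base a))"

lemma arrow_elt_in_path_span:
  "a \<in> arrs Q \<Longrightarrow> arrow_elt Q a \<in> path_span (paths_between Q (src Q a) (tgt Q a))"
  using finite_Q unfolding arrow_elt_conv_basis_elt
  by (intro basis_elt_in_path_span) (auto simp: finite_quiver_def is_path_Cons path_end_Cons)

lemma arrow_substitution_shear: "arrow_substitution Q (shear c)"
proof
  fix a assume a: "a \<in> arrs Q"
  then have "arrow_elt Q (base a) \<in> path_span (paths_between Q (src Q a) (tgt Q a))"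
    using arrow_elt_in_path_span[OF base_arrow[OF a]] by (simp add: src_base tgt_base)
  then show "shear c a \<in> path_span (paths_between Q (src Q a) (tgt Q a))"
    unfolding shear_def using arrow_elt_in_path_span[OF a]
    by (intro pa.subspace_add pa.subspace_scale) simp_all
qed (rule finite_Q)

lemma arrow_subst_shear_inverse:
  assumes "a \<in> arrs Q" and c: "\<And>a. a \<in> arrs Q \<Longrightarrow> c (base a) = 0"
  shows "arrow_subst Q (shear c) (shear (\<lambda>a. - c a) a) = arrow_elt Q a"
proof -
  interpret arrow_substitution Q "shear c" by (rule arrow_substitution_shear)
  have "arrow_subst Q (shear c) (shear (\<lambda>a. - c a) a) =
      shear c a - pa_smult (c a) (shear c (base a))"
    using assms(1)
    by (simp add: shear_def[of "\<lambda>a. - c a"] pa_pair.linear_diff[OF linear_arrow_subst]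
        pa_pair.linear_scale[OF linear_arrow_subst] subst_arrow_elt base_arrow)
  then show ?thesis using assms by (simp add: shear_def)
qed

lemma pa_automorphism_shear:
  assumes "\<And>a. a \<in> arrs Q \<Longrightarrow> c (base a) = 0"
  shows "pa_automorphism Q (arrow_subst Q (shear c))"
  using arrow_subst_shear_inverse[of _ c] arrow_subst_shear_inverse[of _ "\<lambda>a. - c a"] assms
  by (intro pa_automorphism_arrow_subst[where \<eta> = "shear (\<lambda>a. - c a)"] arrow_substitution_shear)
    simp_all

lemma arrow_subst_shear_basis_elt:
  "is_path Q (x, as) \<Longrightarrow> arrow_subst Q (shear c) (basis_elt (x, as)) \<in>
    path_span ({x} \<times> {bs. list_all2 (\<lambda>a b. b = a \<or> b = base a \<and> c a \<noteq> 0) as bs})"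
proof (induction as arbitrary: x)
  case Nil
  show ?case by (auto intro: basis_elt_in_path_span)
next
  case (Cons a as)
  let ?sheared = "\<lambda>a b. b = a \<or> b = base a \<and> c a \<noteq> 0"
  from Cons.prems have a: "a \<in> arrs Q" "src Q a = x" "is_path Q (tgt Q a, as)"
    by (auto simp: is_path_Cons)
  have "shear c a \<in> path_span {(x, [b]) |b. ?sheared a b}"
    using a by (cases "c a = 0") (auto simp: shear_def arrow_elt_conv_basis_elt src_base
        intro!: pa.subspace_add pa.subspace_scale basis_elt_in_path_span)
  from this Cons.IH[OF a(3)] show ?case
    unfolding arrow_subst_Cons
  proof (rule pa_mult_in_subspace[OF subspace_path_span])
    fix p q
    assume "p \<in> {(x, [b]) |b. ?sheared a b}" "q \<in> {tgt Q a} \<times> {bs. list_all2 ?sheared as bs}"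
    then show "pa_mult Q (basis_elt p) (basis_elt q) \<in>
        path_span ({x} \<times> {bs. list_all2 ?sheared (a # as) bs})"
      by (auto simp: pa_mult_basis_elt pa.subspace_0 intro!: basis_elt_in_path_span)
  qed
qed

lemma arrow_subst_shear_fixed:
  "is_path Q (x, as) \<Longrightarrow> (\<And>a. a \<in> set as \<Longrightarrow> c a = 0) \<Longrightarrow>
    arrow_subst Q (shear c) (basis_elt (x, as)) = basis_elt (x, as)"
proof (induction as arbitrary: x)
  case (Cons a as)
  then have path: "is_path Q (tgt Q a, as)" "src Q a = x" by (auto simp: is_path_Cons)
  moreover have "path_end Q (x, [a]) = tgt Q a"
    using Cons.prems(1) is_path_verts[OF path(1)] by (simp add: is_path_Cons path_end_Cons)
  ultimately show ?case
    using Cons by (simp add: shear_def arrow_elt_conv_basis_elt pa_mult_basis_elt)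
qed simp

end

section \<open>Admissible ideals and minimal relations\<close>

definition long_paths :: "quiver \<Rightarrow> nat \<Rightarrow> path set" where
  "long_paths Q m = {p. is_path Q p \<and> m \<le> length (snd p)}"

lemma path_alg_conv_long_paths: "path_alg Q = path_span (long_paths Q 0)"
  by (simp add: path_alg_conv_path_span long_paths_def)

lemma pa_mult_long_paths:
  assumes "f \<in> path_span (long_paths Q m)" "g \<in> path_span (long_paths Q m')"
  shows "pa_mult Q f g \<in> path_span (long_paths Q (m + m'))"
proof (rule pa_mult_in_subspace[OF subspace_path_span assms])
  fix p q assume "p \<in> long_paths Q m" "q \<in> long_paths Q m'"
  then show "pa_mult Q (basis_elt p) (basis_elt q) \<in> path_span (long_paths Q (m + m'))"
    by (cases p, cases q)
      (auto simp: pa_mult_basis_elt long_paths_def pa.subspace_0 intro!: basis_elt_in_path_span)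
qed

lemma pa_ideal_long_paths: "pa_ideal Q (path_span (long_paths Q m))"
  unfolding pa_ideal_iff path_alg_conv_long_paths
proof (intro conjI ballI)
  show "path_span (long_paths Q m) \<subseteq> path_span (long_paths Q 0)"
    by (rule path_span_mono) (auto simp: long_paths_def)
  fix f g :: "path \<Rightarrow> 'a"
  assume "f \<in> path_span (long_paths Q m)" "g \<in> path_span (long_paths Q 0)"
  then show "pa_mult Q g f \<in> path_span (long_paths Q m)" "pa_mult Q f g \<in> path_span (long_paths Q m)"
    using pa_mult_long_paths[of g Q 0 f m] pa_mult_long_paths[of f Q m g 0] by simp_all
qed simp

lemma gen_ideal_least: "pa_ideal Q I \<Longrightarrow> S \<subseteq> I \<Longrightarrow> gen_ideal Q S \<subseteq> I"
  by (auto simp: gen_ideal_def)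

lemma gen_ideal_superset: "S \<subseteq> gen_ideal Q S"
  by (auto simp: gen_ideal_def)

lemma pa_ideal_gen_ideal:
  assumes "S \<subseteq> path_alg Q"
  shows "pa_ideal Q (gen_ideal Q S)"
proof -
  have "pa_ideal Q (path_alg Q)" unfolding path_alg_conv_long_paths by (rule pa_ideal_long_paths)
  then have "gen_ideal Q S \<subseteq> path_alg Q" using assms by (rule gen_ideal_least)
  then show ?thesis unfolding pa_ideal_def by (auto simp: gen_ideal_def pa_ideal_def)
qed

lemma basis_elt_snoc:
  assumes "is_path Q (x, as @ [a])"
  shows "basis_elt (x, as @ [a]) = pa_mult Q (basis_elt (x, as)) (arrow_elt Q a)"
  using assms by (auto simp: arrow_elt_conv_basis_elt pa_mult_basis_elt is_path_append is_path_Cons)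

lemma long_paths_SucE:
  assumes "p \<in> long_paths Q (Suc m)"
  obtains x as a where "p = (x, as @ [a])" "is_path Q (x, as @ [a])"
    "(x, as) \<in> long_paths Q m" "a \<in> arrs Q"
proof -
  obtain x bs where p: "p = (x, bs)" by (cases p)
  with assms obtain as a where "bs = as @ [a]"
    by (cases bs rule: rev_cases) (auto simp: long_paths_def)
  then show ?thesis using assms p that by (auto simp: long_paths_def is_path_append is_path_Cons)
qed

lemma arrow_elt_in_arrow_ideal: "a \<in> arrs Q \<Longrightarrow> arrow_elt Q a \<in> arrow_ideal Q"
  unfolding arrow_ideal_def using gen_ideal_superset by blast

lemma arrow_ideal_subset:
  assumes "finite_quiver Q"
  shows "arrow_ideal Q \<subseteq> path_span (long_paths Q 1)"
  unfolding arrow_ideal_def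
  using assms by (intro gen_ideal_least pa_ideal_long_paths)
    (auto simp: arrow_elt_conv_basis_elt long_paths_def finite_quiver_def is_path_Cons
      intro!: basis_elt_in_path_span)

lemma ideal_power_arrow_ideal:
  assumes Q: "finite_quiver Q"
  shows "ideal_power Q (arrow_ideal Q) m = (path_span (long_paths Q m) :: (path \<Rightarrow> 'k::field) set)"
proof (induction m)
  case 0
  show ?case by (simp add: path_alg_conv_long_paths)
next
  case (Suc m)
  let ?long = "\<lambda>m. path_span (long_paths Q m) :: (path \<Rightarrow> 'k) set"
  let ?products = "{pa_mult Q f g |f g. f \<in> ?long m \<and> g \<in> arrow_ideal Q}"
  have products: "?products \<subseteq> ?long (Suc m)"
    using arrow_ideal_subset[OF Q] pa_mult_long_paths[of _ Q m _ 1] by fastforce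
  have "?long (Suc m) \<subseteq> path_alg Q" using pa_ideal_long_paths by (auto simp: pa_ideal_iff)
  then have "pa.subspace (gen_ideal Q ?products)"
    using pa_ideal_gen_ideal[of ?products Q] products by (auto simp: pa_ideal_iff)
  moreover have "basis_elt p \<in> gen_ideal Q ?products" if "p \<in> long_paths Q (Suc m)" for p
    using that
  proof (rule long_paths_SucE)
    fix x as a
    assume "p = (x, as @ [a])" "is_path Q (x, as @ [a])" "(x, as) \<in> long_paths Q m" "a \<in> arrs Q"
    then show ?thesis
      using arrow_elt_in_arrow_ideal[of a Q] basis_elt_in_path_span[of "(x, as)" "long_paths Q m"]
      by (intro subsetD[OF gen_ideal_superset]) (auto simp: basis_elt_snoc)
  qed
  ultimately have "?long (Suc m) \<subseteq> gen_ideal Q ?products"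
    unfolding path_span_def by (intro pa.span_minimal) auto
  then show ?case using gen_ideal_least[OF pa_ideal_long_paths products] by (simp add: Suc.IH)
qed

lemma admissibleI:
  assumes Q: "finite_quiver Q" and I: "pa_ideal Q I" and long: "I \<subseteq> path_span (long_paths Q 2)"
    and "m \<ge> 2" and short: "\<And>p. is_path Q p \<Longrightarrow> length (snd p) < m"
  shows "admissible Q I"
proof -
  have "long_paths Q m = {}" using short by (auto simp: long_paths_def not_le)
  then have "path_span (long_paths Q m) \<subseteq> I"
    using I by (simp add: path_span_def pa_ideal_iff pa.subspace_0)
  then show ?thesis
    unfolding admissible_def ideal_power_arrow_ideal[OF Q] using I long \<open>m \<ge> 2\<close> by blast
qed

text \<open>In top degree, multiplication by a path either fixes or annihilates a combination of
  parallel paths, so every span of such combinations is an ideal.\<close>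

lemma basis_elt_mult_maximal_paths:
  assumes short: "\<And>p. is_path Q p \<Longrightarrow> length (snd p) \<le> m"
    and f: "f \<in> path_span {p \<in> paths_between Q x y. length (snd p) = m}"
  shows "pa_mult Q (basis_elt p) f \<in> {f, 0}" "pa_mult Q f (basis_elt p) \<in> {f, 0}"
proof -
  obtain z as where p: "p = (z, as)" by (cases p)
  note on_span = pa_linear_eq_on_path_span[OF _ pa.linear_scale_self f]
  have too_long: "\<not> is_path Q (u, as @ bs)" "\<not> is_path Q (u, bs @ as)"
    if "as \<noteq> []" "length bs = m" for u bs
    using that short[of "(u, as @ bs)"] short[of "(u, bs @ as)"] by auto
  have basis: "pa_mult Q (basis_elt p) (basis_elt q) = pa_smult (of_bool (p = (x, []))) (basis_elt q)"
      "pa_mult Q (basis_elt q) (basis_elt p) = pa_smult (of_bool (p = (y, []))) (basis_elt q)"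
    if "q \<in> {p \<in> paths_between Q x y. length (snd p) = m}" for q
  proof -
    obtain bs where q: "q = (x, bs)" "is_path Q (x, bs)" "path_end Q (x, bs) = y" "length bs = m"
      using \<open>q \<in> _\<close> by (cases q) auto
    show "pa_mult Q (basis_elt p) (basis_elt q) = pa_smult (of_bool (p = (x, []))) (basis_elt q)"
      unfolding p q(1) using q(2-4) is_path_verts[OF q(2)]
      by (cases "as = []") (auto simp: pa_mult_basis_elt too_long dest: is_path_verts)
    show "pa_mult Q (basis_elt q) (basis_elt p) = pa_smult (of_bool (p = (y, []))) (basis_elt q)"
      unfolding p q(1) using q(2-4)
      by (cases "as = []") (auto simp: pa_mult_basis_elt too_long)
  qed
  have "pa_mult Q (basis_elt p) f = pa_smult (of_bool (p = (x, []))) f"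
    by (rule on_span[OF linear_pa_mult_right]) (rule basis)
  then show "pa_mult Q (basis_elt p) f \<in> {f, 0}" by simp
  have "pa_mult Q f (basis_elt p) = pa_smult (of_bool (p = (y, []))) f"
    by (rule on_span[OF linear_pa_mult_left]) (rule basis)
  then show "pa_mult Q f (basis_elt p) \<in> {f, 0}" by simp
qed

lemma pa_ideal_span_maximal_paths:
  fixes S :: "(path \<Rightarrow> 'k::field) set"
  assumes short: "\<And>p. is_path Q p \<Longrightarrow> length (snd p) \<le> m"
    and S: "\<And>f. f \<in> S \<Longrightarrow> \<exists>x y. f \<in> path_span {p \<in> paths_between Q x y. length (snd p) = m}"
  shows "pa_ideal Q (pa.span S)"
  unfolding pa_ideal_iff
proof (intro conjI ballI)
  have "path_span {p \<in> paths_between Q x y. length (snd p) = m} \<subseteq> path_alg Q" for x y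
    unfolding path_alg_conv_path_span by (rule path_span_mono) (auto simp: paths_between_def)
  then show "pa.span S \<subseteq> path_alg Q" using S by (intro pa.span_minimal) (blast, simp)
  fix f g :: "path \<Rightarrow> 'k" assume f: "f \<in> pa.span S" and g: "g \<in> path_alg Q"
  have basis: "pa_mult Q (basis_elt p) h \<in> pa.span S" "pa_mult Q h (basis_elt p) \<in> pa.span S"
    if "h \<in> S" for h p
  proof -
    obtain x y where "h \<in> path_span {p \<in> paths_between Q x y. length (snd p) = m}"
      using S[OF \<open>h \<in> S\<close>] by blast
    from basis_elt_mult_maximal_paths[OF short this, of p]
    show "pa_mult Q (basis_elt p) h \<in> pa.span S" "pa_mult Q h (basis_elt p) \<in> pa.span S"
      using that by (auto simp: pa.span_base pa.span_zero)
  qed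
  have gens: "pa_mult Q g h \<in> pa.span S" "pa_mult Q h g \<in> pa.span S" if "h \<in> S" for h
  proof -
    have g_span: "g \<in> path_span {p. is_path Q p}" using g by (simp add: path_alg_conv_path_span)
    show "pa_mult Q g h \<in> pa.span S"
      by (rule pa_linear_path_span_in_subspace[OF linear_pa_mult_left pa.subspace_span _ g_span])
        (rule basis(1)[OF that])
    show "pa_mult Q h g \<in> pa.span S"
      by (rule pa_linear_path_span_in_subspace[OF linear_pa_mult_right pa.subspace_span _ g_span])
        (rule basis(2)[OF that])
  qed
  show "pa_mult Q g f \<in> pa.span S"
    by (rule pa_linear_span_in_subspace[OF linear_pa_mult_right pa.subspace_span gens(1) f])
  show "pa_mult Q f g \<in> pa.span S"
    by (rule pa_linear_span_in_subspace[OF linear_pa_mult_left pa.subspace_span gens(2) f])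
qed simp

lemma minimal_relation_binomial:
  assumes I: "pa.subspace I" and parallel: "fst p = fst q" "path_end Q p = path_end Q q"
    and "p \<noteq> q" and q: "basis_elt q \<notin> I" and diff: "basis_elt p - basis_elt q \<in> I"
  shows "minimal_relation Q I (basis_elt p - basis_elt q)"
proof -
  let ?r = "basis_elt p - basis_elt q :: path \<Rightarrow> 'a"
  have supp: "supp ?r = {p, q}"
    using \<open>p \<noteq> q\<close> by (auto simp: supp_def basis_elt_def)
  have p: "basis_elt p \<notin> I" using q pa.subspace_diff[OF I _ diff, of "basis_elt p"] by auto
  have "(\<lambda>s. if s \<in> K then ?r s else 0) \<notin> I" if "K \<subset> {p, q}" "K \<noteq> {}" for K
  proof -
    have "K = {p} \<or> K = {q}" using that by blast
    then have "(\<lambda>s. if s \<in> K then ?r s else 0) \<in> {basis_elt p, - basis_elt q}"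
      using \<open>p \<noteq> q\<close> by (auto simp: basis_elt_def)
    then show ?thesis using p q pa.subspace_neg[OF I, of "- basis_elt q"] by auto
  qed
  then show ?thesis
    using diff parallel \<open>p \<noteq> q\<close> unfolding minimal_relation_def supp by auto
qed

lemma htpy_binomial:
  assumes "is_path Q p" and "pa.subspace I" "fst p = fst q" "path_end Q p = path_end Q q"
    "basis_elt q \<notin> I" "basis_elt p - basis_elt q \<in> I"
  shows "htpy Q I (fst p, fwd (snd p)) (fst q, fwd (snd q))"
proof (cases "p = q")
  case True
  then show ?thesis using assms(1) by (auto intro: h_refl simp: is_path_def)
next
  case False
  then have "minimal_relation Q I (basis_elt p - basis_elt q)"
    using assms by (intro minimal_relation_binomial)
  then show ?thesis using False by (rule_tac h_rel) (auto simp: supp_def basis_elt_def)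
qed

lemma minimal_relation_homogeneous:
  assumes S: "\<And>f. f \<in> S \<Longrightarrow> \<exists>d. f \<in> path_span {p. D p = d}"
    and min: "minimal_relation Q (pa.span S) r" and pq: "p \<in> supp r" "q \<in> supp r"
  shows "D p = D q"
proof (rule ccontr)
  assume neq: "D p \<noteq> D q"
  define component where "component f s = (if D s = D p then f s else 0)" for f :: "path \<Rightarrow> 'a" and s
  have linear: "pa_linear component"
    by (rule pa_linearI) (auto simp: component_def pa_smult_def)
  have "component f \<in> pa.span S" if "f \<in> S" for f
  proof -
    obtain d where "f \<in> path_span {p. D p = d}" using S[OF \<open>f \<in> S\<close>] by blast
    then have "f s \<noteq> 0 \<longrightarrow> D s = d" for s by (cases s) (auto simp: mem_path_span_iff)
    then have "component f = (if d = D p then f else 0)" by (auto simp: component_def fun_eq_iff)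
    then show ?thesis using that by (simp add: pa.span_base pa.span_zero)
  qed
  moreover have "r \<in> pa.span S" using min by (simp add: minimal_relation_def)
  ultimately have "component r \<in> pa.span S"
    by (rule pa_linear_span_in_subspace[OF linear pa.subspace_span])
  let ?K = "{s \<in> supp r. D s = D p}"
  have "q \<notin> ?K" using neq by simp
  then have "?K \<subset> supp r" "?K \<noteq> {}" using pq by blast+
  then have "(\<lambda>s. if s \<in> ?K then r s else 0) \<notin> pa.span S"
    using min unfolding minimal_relation_def by blast
  moreover have "(\<lambda>s. if s \<in> ?K then r s else 0) = component r"
    by (auto simp: component_def supp_def)
  ultimately show False using \<open>component r \<in> pa.span S\<close> by simp
qed

section \<open>Homotopy of walks\<close>

lemma walk_end_inv_word: "walk_end Q x s = Some y \<Longrightarrow> walk_end Q y (inv_word s) = Some x"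
proof (induction s arbitrary: x)
  case (Cons e s)
  obtain a d where e: "e = (a, d)" by (cases e)
  let ?z = "if d then tgt Q a else src Q a"
  have "walk_end Q ?z s = Some y" "x \<in> verts Q" "a \<in> arrs Q" "x = (if d then src Q a else tgt Q a)"
    using Cons.prems by (auto simp: e split: if_splits)
  moreover from this(1) have "?z \<in> verts Q" by (rule walk_end_Some_start)
  ultimately show ?case using Cons.IH[of ?z] by (cases d) (simp_all add: e walk_end_append)
qed (auto split: if_splits)

lemma connected_quiverI:
  assumes "v0 \<in> verts Q" and tree: "\<And>v. v \<in> verts Q \<Longrightarrow> walk_end Q v0 (tree v) = Some v"
  shows "connected_quiver Q"
proof -
  have "walk_end Q x (inv_word (tree x) @ tree y) = Some y" if "x \<in> verts Q" "y \<in> verts Q" for x y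
    using tree that walk_end_inv_word[OF tree[OF that(1)]] by (simp add: walk_end_append)
  then show ?thesis using assms(1) unfolding connected_quiver_def by blast
qed

locale bound_quiver =
  fixes Q :: quiver and I :: "(path \<Rightarrow> 'k::field) set"
  assumes finite_Q: "finite_quiver Q" and I: "I \<subseteq> path_alg Q"
begin

abbreviation homotopic :: "nat \<Rightarrow> (nat \<times> bool) list \<Rightarrow> (nat \<times> bool) list \<Rightarrow> bool" where
  "homotopic x s t \<equiv> htpy Q I (x, s) (x, t)"

lemmas [trans] = h_trans[of Q I]

lemma htpy_walk_end:
  "htpy Q I u v \<Longrightarrow> fst u = fst v \<and> walk_end Q (fst u) (snd u) = walk_end Q (fst v) (snd v) \<and>
    walk_end Q (fst u) (snd u) \<noteq> None"
proof (induction rule: htpy.induct)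
  case (h_rel \<rho> p q)
  have "\<rho> \<in> path_alg Q" using h_rel I by (auto simp: minimal_relation_def)
  then have "is_path Q p" "is_path Q q" using h_rel(2,3) unfolding path_alg_def supp_def by blast+
  moreover have "fst p = fst q" "path_end Q p = path_end Q q"
    using h_rel unfolding minimal_relation_def by metis+
  ultimately show ?case by (auto simp: is_path_def path_end_def)
next
  case (h_ctx x u v z w w')
  then show ?case by (auto simp: walk_end_append split: option.splits)
qed (use finite_Q in \<open>auto simp: finite_quiver_def\<close>)

lemma homotopic_walk_end: "homotopic x s t \<Longrightarrow> walk_end Q x s = walk_end Q x t"
  using htpy_walk_end by fastforce

lemma homotopic_defined: "homotopic x s t \<Longrightarrow> walk_end Q x s \<noteq> None"
  using htpy_walk_end by fastforce

lemma homotopic_refl: "walk_end Q x s = Some y \<Longrightarrow> homotopic x s s"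
  by (rule h_refl) simp

lemma homotopic_append:
  assumes s: "homotopic x s s'" and t: "homotopic y t t'" and y: "walk_end Q x s = Some y"
  shows "homotopic x (s @ t) (s' @ t')"
proof -
  have x: "walk_end Q x [] = Some x" using walk_end_Some_start[OF y] by simp
  have y': "walk_end Q x s' = Some y" using homotopic_walk_end[OF s] y by simp
  have defined: "walk_end Q x (s @ t) \<noteq> None" "walk_end Q x (s' @ t) \<noteq> None"
      "walk_end Q x (s' @ t') \<noteq> None"
    using y y' homotopic_defined[OF t] homotopic_walk_end[OF t] by (auto simp: walk_end_append)
  have "homotopic x ([] @ s @ t) ([] @ s' @ t)" by (rule h_ctx[OF s x]) (use defined in auto)
  moreover have "homotopic x (s' @ t @ []) (s' @ t' @ [])"
    by (rule h_ctx[OF t y']) (use defined in auto)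
  ultimately show ?thesis by (auto intro: h_trans)
qed

lemma homotopic_append_left:
  "homotopic y t t' \<Longrightarrow> walk_end Q x s = Some y \<Longrightarrow> homotopic x (s @ t) (s @ t')"
  by (auto intro: homotopic_append homotopic_refl)

lemma homotopic_append_right:
  "homotopic x s s' \<Longrightarrow> walk_end Q x s = Some y \<Longrightarrow> walk_end Q y t = Some z \<Longrightarrow>
    homotopic x (s @ t) (s' @ t)"
  by (auto intro: homotopic_append homotopic_refl)

lemma homotopic_right_inverse: "walk_end Q x s = Some y \<Longrightarrow> homotopic x (s @ inv_word s) []"
proof (induction s arbitrary: x)
  case Nil
  then show ?case by (auto intro: homotopic_refl)
next
  case (Cons e s)
  obtain a d where e: "e = (a, d)" by (cases e)
  obtain z where z: "walk_end Q x [e] = Some z" "walk_end Q z s = Some y"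
    using Cons.prems walk_end_append[of Q x "[e]" s] by (auto split: option.splits)
  have inv_e: "walk_end Q z (inv_word [e]) = Some x" using walk_end_inv_word[OF z(1)] .
  have "homotopic x ([e] @ (s @ inv_word s) @ inv_word [e]) ([e] @ [] @ inv_word [e])"
    using Cons.IH[OF z(2)] z walk_end_inv_word[OF z(2)] inv_e
    by (intro homotopic_append_left homotopic_append_right) (auto simp: walk_end_append)
  also have "homotopic x ([e] @ [] @ inv_word [e]) []"
    using z(1) h_cancel1[of a Q I] h_cancel2[of a Q I] by (cases d) (auto simp: e split: if_splits)
  finally show ?case by (simp add: e)
qed

lemma homotopic_left_inverse: "walk_end Q x s = Some y \<Longrightarrow> homotopic y (inv_word s @ s) []"
  using homotopic_right_inverse[OF walk_end_inv_word, of x s y] by simp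

lemma homotopic_insert_right_inverse:
  assumes "walk_end Q x s = Some y" "walk_end Q x t = Some z"
  shows "homotopic x t (s @ inv_word s @ t)"
  using homotopic_append_right[OF homotopic_right_inverse[OF assms(1)], of x t z] assms
    walk_end_inv_word[OF assms(1)]
  by (simp add: walk_end_append h_sym)

lemma homotopic_cancel_left:
  assumes "homotopic x (r @ s) (r @ t)" "walk_end Q x r = Some y"
  shows "homotopic y s t"
proof -
  note inv_r = walk_end_inv_word[OF assms(2)]
  obtain z where z: "walk_end Q y s = Some z" "walk_end Q y t = Some z"
    using homotopic_defined[OF assms(1)] homotopic_walk_end[OF assms(1)] assms(2)
    by (auto simp: walk_end_append)
  have "homotopic y s (inv_word r @ r @ s)"
    using homotopic_insert_right_inverse[OF inv_r z(1)] by simp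
  also have "homotopic y (inv_word r @ r @ s) (inv_word r @ r @ t)"
    using assms(1) inv_r by (rule homotopic_append_left)
  also have "homotopic y (inv_word r @ r @ t) t"
    using homotopic_insert_right_inverse[OF inv_r z(2)] by (simp add: h_sym)
  finally show ?thesis .
qed

lemma homotopic_cancel_right:
  assumes "homotopic x (s @ r) (t @ r)" "walk_end Q x s = Some y" "walk_end Q x t = Some y"
  shows "homotopic x s t"
proof -
  obtain z where r: "walk_end Q y r = Some z"
    using homotopic_defined[OF assms(1)] assms(2) by (auto simp: walk_end_append)
  have remove: "homotopic x ((s @ r) @ inv_word r) s" if "walk_end Q x s = Some y" for s
    using homotopic_append_left[OF homotopic_right_inverse[OF r] that] by simp
  have "homotopic x s ((s @ r) @ inv_word r)" using remove[OF assms(2)] by (rule h_sym)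
  also have "homotopic x ((s @ r) @ inv_word r) ((t @ r) @ inv_word r)"
    using assms(1,2) r walk_end_inv_word[OF r]
    by (auto intro!: homotopic_append_right[OF assms(1)] simp: walk_end_append
        simp del: append_assoc)
  also have "homotopic x ((t @ r) @ inv_word r) t" using remove[OF assms(3)] .
  finally show ?thesis .
qed

end

text \<open>\<open>word_hom label\<close> and \<open>word_hom gen\<close> induce mutually inverse maps between the fundamental
  group at \<open>v0\<close> and the presented group; conjugation by \<open>tree\<close> changes the base point.\<close>

locale homotopy_presentation = bound_quiver Q I for Q and I :: "(path \<Rightarrow> 'k::field) set" +
  fixes v0 :: nat and X :: "nat set" and R :: "word set"
    and label :: "nat \<Rightarrow> word" and gen :: "nat \<Rightarrow> word" and tree :: "nat \<Rightarrow> word"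
  assumes label_in_lists: "a \<in> arrs Q \<Longrightarrow> label a \<in> lists (X \<times> UNIV)"
    and label_minimal_relation: "minimal_relation Q I \<rho> \<Longrightarrow> p \<in> supp \<rho> \<Longrightarrow> q \<in> supp \<rho> \<Longrightarrow>
      pres_eq R (word_hom label (fwd (snd p))) (word_hom label (fwd (snd q)))"
    and walk_end_gen: "walk_end Q v0 (gen x) = Some v0"
    and label_gen: "x \<in> X \<Longrightarrow> word_hom label (gen x) = [(x, True)]"
    and gen_relator: "r \<in> R \<Longrightarrow> homotopic v0 (word_hom gen r) []"
    and walk_end_tree: "v \<in> verts Q \<Longrightarrow> walk_end Q v0 (tree v) = Some v"
    and label_tree: "v \<in> verts Q \<Longrightarrow> word_hom label (tree v) = []"
    and tree_arrow: "a \<in> arrs Q \<Longrightarrow>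
      homotopic v0 (tree (src Q a) @ [(a, True)]) (word_hom gen (label a) @ tree (tgt Q a))"
begin

lemma walk_end_word_hom_gen [simp]: "walk_end Q v0 (word_hom gen u) = Some v0"
proof (induction u)
  case Nil
  show ?case using walk_end_Some_start[OF walk_end_gen] by simp
next
  case (Cons l u)
  then show ?case using walk_end_gen walk_end_inv_word[OF walk_end_gen]
    by (cases l) (simp add: walk_end_append)
qed

lemma homotopic_word_hom_gen_delete:
  assumes "homotopic v0 (word_hom gen w) []"
  shows "homotopic v0 (word_hom gen (u @ w @ v)) (word_hom gen (u @ v))"
proof -
  have "homotopic v0 (word_hom gen w @ word_hom gen v) ([] @ word_hom gen v)"
    by (rule homotopic_append_right[OF assms walk_end_word_hom_gen walk_end_word_hom_gen])
  then show ?thesis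
    using homotopic_append_left[of v0 _ _ v0 "word_hom gen u"] by simp
qed

lemma homotopic_word_hom_gen: "pres_eq R u v \<Longrightarrow> homotopic v0 (word_hom gen u) (word_hom gen v)"
proof (induction rule: pres_eq.induct)
  case (pe_refl u)
  show ?case by (rule homotopic_refl) simp
next
  case (pe_cancel u x b v)
  have "homotopic v0 (word_hom gen [(x, b)] @ inv_word (word_hom gen [(x, b)])) []"
    by (rule homotopic_right_inverse[OF walk_end_word_hom_gen])
  then have "homotopic v0 (word_hom gen [(x, b), (x, \<not> b)]) []" by (cases b) simp_all
  then show ?case by (rule homotopic_word_hom_gen_delete)
next
  case (pe_rel r u v)
  show ?case using gen_relator[OF pe_rel] by (rule homotopic_word_hom_gen_delete)
qed (blast intro: h_sym h_trans)+

lemma htpy_label: "htpy Q I u v \<Longrightarrow>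
    pres_eq R (word_hom label (snd u)) (word_hom label (snd v))"
proof (induction rule: htpy.induct)
  case (h_rel \<rho> p q)
  then show ?case using label_minimal_relation by simp
next
  case (h_ctx x u v z w w')
  then show ?case using pres_eq_context by simp
qed (auto simp: pres_eq_right_inverse pres_eq_left_inverse intro: pe_refl pe_sym pe_trans)

lemma tree_inverse_arrow:
  assumes a: "a \<in> arrs Q"
  shows "homotopic v0 (tree (tgt Q a) @ [(a, False)])
    (inv_word (word_hom gen (label a)) @ tree (src Q a))"
proof -
  let ?w = "word_hom gen (label a)"
  have v: "src Q a \<in> verts Q" "tgt Q a \<in> verts Q" using a finite_Q by (auto simp: finite_quiver_def)
  note ends = walk_end_tree[OF v(1)] walk_end_tree[OF v(2)] walk_end_inv_word[of Q v0 ?w v0]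
  have "homotopic v0 (?w @ tree (tgt Q a) @ [(a, False)])
      ((tree (src Q a) @ [(a, True)]) @ [(a, False)])"
    using homotopic_append_right[OF h_sym[OF tree_arrow[OF a]], of "tgt Q a" _ "src Q a"]
      a v ends by (simp add: walk_end_append)
  also have "htpy Q I \<dots> (v0, tree (src Q a))"
    using homotopic_append_left[OF h_cancel1[OF a] ends(1)] by simp
  also have "htpy Q I \<dots> (v0, ?w @ inv_word ?w @ tree (src Q a))"
    using ends by (intro homotopic_insert_right_inverse) simp_all
  finally show ?thesis by (rule homotopic_cancel_left) simp
qed

lemma tree_walk:
  "walk_end Q x s = Some y \<Longrightarrow> homotopic v0 (tree x @ s) (word_hom gen (word_hom label s) @ tree y)"
proof (induction s arbitrary: x)
  case Nil
  then have "x = y" "x \<in> verts Q" by (simp_all split: if_splits)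
  then show ?case using walk_end_tree by (auto intro: homotopic_refl)
next
  case (Cons e s)
  obtain a d where e: "e = (a, d)" by (cases e)
  obtain z where z: "walk_end Q x [e] = Some z" "walk_end Q z s = Some y"
    using Cons.prems walk_end_append[of Q x "[e]" s] by (auto split: option.splits)
  let ?w = "word_hom gen (word_hom label [e])"
  have "homotopic v0 (tree x @ [e]) (?w @ tree z)"
    using z(1) tree_arrow[of a] tree_inverse_arrow[of a]
    by (cases d) (auto simp: e split: if_splits)
  then have "homotopic v0 ((tree x @ [e]) @ s) ((?w @ tree z) @ s)"
    using z walk_end_tree[OF walk_end_Some_start[OF z(1)]]
    by (intro homotopic_append_right) (auto simp: walk_end_append)
  also have "homotopic v0 ((?w @ tree z) @ s) (?w @ word_hom gen (word_hom label s) @ tree y)"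
    using homotopic_append_left[OF Cons.IH[OF z(2)], of v0 ?w] by simp
  finally show ?case by (simp add: e)
qed

lemma homotopic_iff_label:
  assumes "walk_end Q x s = Some y" "walk_end Q x t = Some y"
  shows "homotopic x s t \<longleftrightarrow> pres_eq R (word_hom label s) (word_hom label t)"
proof
  assume label: "pres_eq R (word_hom label s) (word_hom label t)"
  have ends: "walk_end Q v0 (tree x) = Some x" "walk_end Q v0 (tree y) = Some y"
    using walk_end_tree walk_end_Some_start[OF walk_end_inv_word[OF assms(1)]]
      walk_end_Some_start[OF assms(1)] by simp_all
  note tree_walk[OF assms(1)]
  also have "homotopic v0 (word_hom gen (word_hom label s) @ tree y)
      (word_hom gen (word_hom label t) @ tree y)"
    using ends by (intro homotopic_append_right[OF homotopic_word_hom_gen[OF label]]) simp_all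
  also note h_sym[OF tree_walk[OF assms(2)]]
  finally show "homotopic x s t" using ends(1) by (rule homotopic_cancel_left)
qed (use htpy_label in fastforce)

lemma label_walk_in_lists:
  assumes "walk_end Q x s = Some y"
  shows "word_hom label s \<in> lists (X \<times> UNIV)"
proof (rule word_hom_in_lists)
  fix a d assume "(a, d) \<in> set s"
  then have "a \<in> arrs Q" using assms
    by (induction s arbitrary: x) (auto split: if_splits)
  then show "label a \<in> lists (X \<times> UNIV)" by (rule label_in_lists)
qed

lemma label_word_hom_gen: "u \<in> lists (X \<times> UNIV) \<Longrightarrow> word_hom label (word_hom gen u) = u"
  by (induction u) (auto simp: label_gen)

theorem pi1_iso_presented_group:
  assumes v: "v \<in> verts Q"
  shows "pi1 Q I v \<cong> presented_group X R"
  unfolding pi1_def presented_group_def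
proof (rule quot_monoid_iso[where f = "\<lambda>p. word_hom label (snd p)"])
  let ?D = "{(v, s) |s. walk_end Q v s = Some v}"
  show "monoid_congruence (htpy Q I) ?D (\<lambda>(x, s) (y, t). (x, s @ t))"
    by standard (auto simp: walk_end_append intro: homotopic_refl homotopic_append h_sym h_trans)
  show "monoid_congruence (pres_eq R) (lists (X \<times> UNIV)) (@)"
    by standard (auto intro: pe_refl pe_sym pe_trans pres_eq_append)
  show "word_hom label (snd p) \<in> lists (X \<times> UNIV)" if "p \<in> ?D" for p
    using that label_walk_in_lists by fastforce
  show "htpy Q I p q \<longleftrightarrow> pres_eq R (word_hom label (snd p)) (word_hom label (snd q))"
    if "p \<in> ?D" "q \<in> ?D" for p q
    using that homotopic_iff_label[of v _ v] by auto
  show "\<exists>p\<in>?D. pres_eq R (word_hom label (snd p)) u" if "u \<in> lists (X \<times> UNIV)" for u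
  proof (rule bexI)
    show "(v, inv_word (tree v) @ word_hom gen u @ tree v) \<in> ?D"
      using walk_end_tree[OF v] walk_end_inv_word[OF walk_end_tree[OF v]]
      by (simp add: walk_end_append)
    show "pres_eq R (word_hom label (snd (v, inv_word (tree v) @ word_hom gen u @ tree v))) u"
      by (simp add: label_tree[OF v] label_word_hom_gen[OF that] pe_refl)
  qed
qed auto

end

section \<open>The quiver of a family of presentations\<close>

text \<open>A tag \<open>Some (i, u)\<close> stands for the element \<open>u\<close> of the \<open>i\<close>-th group and \<open>None\<close> for the common
  unit of all groups.\<close>

type_synonym tag = "(nat \<times> word) option"

datatype arrow = Alpha tag | Beta tag | Gamma | Delta

instance arrow :: countable
  by countable_datatype

abbreviation \<alpha> :: "tag \<Rightarrow> nat" where "\<alpha> t \<equiv> to_nat (Alpha t)"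
abbreviation \<beta> :: "tag \<Rightarrow> nat" where "\<beta> t \<equiv> to_nat (Beta t)"
abbreviation \<gamma> :: nat where "\<gamma> \<equiv> to_nat Gamma"
abbreviation \<delta> :: nat where "\<delta> \<equiv> to_nat Delta"

definition tag :: "nat \<Rightarrow> word \<Rightarrow> tag" where
  "tag i u = (if u = [] then None else Some (i, u))"

definition tag_label :: "nat \<Rightarrow> tag \<Rightarrow> word" where
  "tag_label i t = (case t of None \<Rightarrow> [] | Some (j, u) \<Rightarrow> if j = i then u else [])"

definition tag_shift :: "nat \<Rightarrow> tag \<Rightarrow> 'k::field" where
  "tag_shift i t = (case t of None \<Rightarrow> 0 | Some (j, u) \<Rightarrow> if j = i then 0 else - 1)"

lemma tag_Nil [simp]: "tag i [] = None"
  and tag_label_tag [simp]: "tag_label i (tag j u) = (if j = i then u else [])"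
  and tag_shift_tag [simp]: "tag_shift i (tag i u) = 0"
  by (simp_all add: tag_def tag_label_def tag_shift_def)

lemma tag_None [simp]: "tag_label i None = []" "tag_shift i None = 0"
  and tag_off [simp]: "j \<noteq> i \<Longrightarrow> tag_label i (Some (j, u)) = []"
    "j \<noteq> i \<Longrightarrow> tag_shift i (Some (j, u)) = - 1"
  by (simp_all add: tag_label_def tag_shift_def)

lemma tag_label_eq_Nil: "tag_shift i t \<noteq> (0::'k::field) \<Longrightarrow> tag_label i t = []"
  by (auto simp: tag_label_def tag_shift_def split: option.splits if_splits)

definition base :: "nat \<Rightarrow> nat" where
  "base e = (case from_nat e of Alpha t \<Rightarrow> \<alpha> None | Beta t \<Rightarrow> \<beta> None | Gamma \<Rightarrow> \<gamma> | Delta \<Rightarrow> \<delta>)"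

definition label :: "nat \<Rightarrow> nat \<Rightarrow> word" where
  "label i e = (case from_nat e of Alpha t \<Rightarrow> tag_label i t | Beta t \<Rightarrow> tag_label i t | _ \<Rightarrow> [])"

definition shift :: "nat \<Rightarrow> nat \<Rightarrow> 'k::field" where
  "shift i e = (case from_nat e of Alpha t \<Rightarrow> tag_shift i t | Beta t \<Rightarrow> tag_shift i t | _ \<Rightarrow> 0)"

lemma base_simps [simp]: "base (\<alpha> t) = \<alpha> None" "base (\<beta> t) = \<beta> None" "base \<gamma> = \<gamma>" "base \<delta> = \<delta>"
  and label_simps [simp]: "label i (\<alpha> t) = tag_label i t" "label i (\<beta> t) = tag_label i t"
    "label i \<gamma> = []" "label i \<delta> = []"
  and shift_simps [simp]: "shift i (\<alpha> t) = tag_shift i t" "shift i (\<beta> t) = tag_shift i t"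
    "shift i \<gamma> = 0" "shift i \<delta> = 0"
  by (simp_all add: base_def label_def shift_def)

lemma shift_base [simp]: "shift i (base e) = 0"
  by (simp add: base_def split: arrow.split)

lemma label_base: "shift i e \<noteq> (0::'k::field) \<Longrightarrow> label i (base e) = label i e"
  by (auto simp: base_def label_def shift_def tag_label_eq_Nil split: arrow.splits)

locale presentation_family =
  fixes n :: nat and X :: "nat \<Rightarrow> nat set" and R :: "nat \<Rightarrow> word set"
  assumes finite_X: "i < n \<Longrightarrow> finite (X i)" and finite_R: "i < n \<Longrightarrow> finite (R i)"
    and R_subset: "i < n \<Longrightarrow> R i \<subseteq> lists (X i \<times> UNIV)"
begin

definition words :: "nat \<Rightarrow> word set" where
  "words i = {u \<in> lists (X i \<times> UNIV). length u \<le> Max (insert 1 (length ` R i))}"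

lemma Nil_words [simp]: "[] \<in> words i"
  by (simp add: words_def)

lemma finite_words: "i < n \<Longrightarrow> finite (words i)"
  unfolding words_def lists_eq_set mem_Collect_eq
  by (rule finite_lists_length_le) (simp add: finite_X)

lemma letter_words: "i < n \<Longrightarrow> x \<in> X i \<Longrightarrow> [(x, b)] \<in> words i"
  using finite_R by (simp add: words_def)

lemma relator_words: "i < n \<Longrightarrow> r \<in> R i \<Longrightarrow> r \<in> words i"
  using finite_R[of i] R_subset[of i] by (auto simp: words_def intro!: Max_ge)

definition tags :: "tag set" where
  "tags = insert None (\<Union>i<n. tag i ` words i)"

lemma finite_tags: "finite tags"
  by (simp add: tags_def finite_words)

lemma None_tags [simp]: "None \<in> tags"
  by (simp add: tags_def)

lemma tag_tags: "i < n \<Longrightarrow> u \<in> words i \<Longrightarrow> tag i u \<in> tags"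
  by (auto simp: tags_def)

lemma tags_cases:
  assumes "t \<in> tags" "i < n"
  obtains (on) u where "t = tag i u" "u \<in> words i" | (off) j u where "t = Some (j, u)" "j \<noteq> i"
proof (cases t)
  case None
  then show ?thesis using on[of "[]"] by simp
next
  case (Some s)
  then obtain j u where "j < n" "u \<in> words j" "t = tag j u" using assms by (auto simp: tags_def)
  then show ?thesis using on off Some by (cases "j = i") (auto simp: tag_def split: if_splits)
qed

definition Q :: quiver where
  "Q = \<lparr>verts = {..4}, arrs = to_nat ` (Alpha ` tags \<union> Beta ` tags \<union> {Gamma, Delta}),
    src = (\<lambda>e. case from_nat e of Alpha t \<Rightarrow> 0 | Beta t \<Rightarrow> 1 | Gamma \<Rightarrow> 1 | Delta \<Rightarrow> 4),
    tgt = (\<lambda>e. case from_nat e of Alpha t \<Rightarrow> 1 | Beta t \<Rightarrow> 2 | Gamma \<Rightarrow> 3 | Delta \<Rightarrow> 1)\<rparr>"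

lemma verts_Q [simp]: "verts Q = {..4}"
  and arrs_Q [simp]: "\<alpha> t \<in> arrs Q \<longleftrightarrow> t \<in> tags" "\<beta> t \<in> arrs Q \<longleftrightarrow> t \<in> tags" "\<gamma> \<in> arrs Q" "\<delta> \<in> arrs Q"
  and src_Q [simp]: "src Q (\<alpha> t) = 0" "src Q (\<beta> t) = 1" "src Q \<gamma> = 1" "src Q \<delta> = 4"
  and tgt_Q [simp]: "tgt Q (\<alpha> t) = 1" "tgt Q (\<beta> t) = 2" "tgt Q \<gamma> = 3" "tgt Q \<delta> = 1"
  by (auto simp: Q_def)

lemma arrs_cases:
  assumes "e \<in> arrs Q"
  obtains (Alpha) t where "e = \<alpha> t" "t \<in> tags" | (Beta) t where "e = \<beta> t" "t \<in> tags"
    | (Gamma) "e = \<gamma>" | (Delta) "e = \<delta>"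
  using assms by (auto simp: Q_def)

lemma finite_quiver_Q: "finite_quiver Q"
proof -
  have "finite (arrs Q)" by (simp add: Q_def finite_tags)
  then show ?thesis by (auto simp: finite_quiver_def elim!: arrs_cases)
qed

sublocale parallel_arrows Q base
proof
  show "finite_quiver Q" by (rule finite_quiver_Q)
qed (auto elim!: arrs_cases)

definition height :: "nat \<Rightarrow> nat" where
  "height v = (if v = 0 \<or> v = 4 then 0 else if v = 1 then 1 else 2)"

lemma height_path_end_Q: "is_path Q (x, as) \<Longrightarrow> height (path_end Q (x, as)) = height x + length as"
  by (rule height_path_end) (auto simp: height_def elim!: arrs_cases)

lemma path_length_le_2: "is_path Q p \<Longrightarrow> length (snd p) \<le> 2"
  using height_path_end_Q[of "fst p" "snd p"] by (auto simp: height_def split: if_splits)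

lemma no_oriented_cycles_Q: "no_oriented_cycles Q"
  using height_path_end_Q by (fastforce simp: no_oriented_cycles_def)

lemma is_path_2 [simp]: "is_path Q (x, [e, e']) \<longleftrightarrow>
    e \<in> arrs Q \<and> e' \<in> arrs Q \<and> src Q e = x \<and> tgt Q e = src Q e'"
  using finite_quiver_Q by (auto simp: is_path_Cons finite_quiver_def)

lemma path_end_2 [simp]: "is_path Q (x, [e, e']) \<Longrightarrow> path_end Q (x, [e, e']) = tgt Q e'"
  using finite_quiver_Q by (auto simp: path_end_def fwd_def finite_quiver_def)

definition tree :: "nat \<Rightarrow> word" where
  "tree v = (if v = 0 then [] else if v = 1 then [(\<alpha> None, True)]
    else if v = 2 then [(\<alpha> None, True), (\<beta> None, True)]
    else if v = 3 then [(\<alpha> None, True), (\<gamma>, True)] else [(\<alpha> None, True), (\<delta>, False)])"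

lemma walk_end_tree: "v \<in> verts Q \<Longrightarrow> walk_end Q 0 (tree v) = Some v"
  by (auto simp: tree_def)

lemma connected_quiver_Q: "connected_quiver Q"
  by (rule connected_quiverI[OF _ walk_end_tree]) simp

section \<open>The base ideal and its shears\<close>

inductive_set base_relations :: "(path \<Rightarrow> 'k::field) set" where
  mult: "i < n \<Longrightarrow> u \<in> words i \<Longrightarrow> v \<in> words i \<Longrightarrow> u' \<in> words i \<Longrightarrow> v' \<in> words i \<Longrightarrow>
    pres_eq (R i) (u @ v) (u' @ v') \<Longrightarrow>
    basis_elt (0, [\<alpha> (tag i u), \<beta> (tag i v)]) - basis_elt (0, [\<alpha> (tag i u'), \<beta> (tag i v')])
      \<in> base_relations"
| left: "Some t \<in> tags \<Longrightarrow> basis_elt (0, [\<alpha> (Some t), \<gamma>]) \<in> base_relations"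
| right: "Some t \<in> tags \<Longrightarrow> basis_elt (4, [\<delta>, \<beta> (Some t)]) \<in> base_relations"

definition base_ideal :: "(path \<Rightarrow> 'k::field) set" where
  "base_ideal = pa.span base_relations"

definition shear_off :: "nat \<Rightarrow> (path \<Rightarrow> 'k::field) \<Rightarrow> path \<Rightarrow> 'k" where
  "shear_off i = arrow_subst Q (shear (shift i))"

definition sheared_ideal :: "nat \<Rightarrow> (path \<Rightarrow> 'k::field) set" where
  "sheared_ideal i = shear_off i ` base_ideal"

lemma base_relations_maximal_paths:
  assumes "f \<in> base_relations"
  shows "\<exists>x y. f \<in> path_span {p \<in> paths_between Q x y. length (snd p) = 2}"
  using assms
proof (cases rule: base_relations.cases)
  case mult
  then show ?thesis
    by (intro exI[of _ 0] exI[of _ 2])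
      (auto intro!: pa.subspace_diff basis_elt_in_path_span simp: tag_tags)
next
  case left
  then show ?thesis by (intro exI[of _ 0] exI[of _ 3]) (auto intro!: basis_elt_in_path_span)
next
  case right
  then show ?thesis by (intro exI[of _ 4] exI[of _ 2]) (auto intro!: basis_elt_in_path_span)
qed

lemma pa_ideal_base_ideal: "pa_ideal Q base_ideal"
  unfolding base_ideal_def
  by (rule pa_ideal_span_maximal_paths[OF path_length_le_2 base_relations_maximal_paths])

lemma pa_automorphism_shear_off: "pa_automorphism Q (shear_off i)"
  unfolding shear_off_def by (rule pa_automorphism_shear) simp

lemma linear_shear_off: "pa_linear (shear_off i)"
  unfolding shear_off_def by (rule linear_arrow_subst)

lemma shear_off_fixed:
  "is_path Q (x, as) \<Longrightarrow> (\<And>e. e \<in> set as \<Longrightarrow> shift i e = (0::'k::field)) \<Longrightarrow>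
    shear_off i (basis_elt (x, as)) = (basis_elt (x, as) :: path \<Rightarrow> 'k)"
  unfolding shear_off_def by (rule arrow_subst_shear_fixed)

lemma pa_ideal_sheared_ideal: "pa_ideal Q (sheared_ideal i)"
  unfolding sheared_ideal_def
  by (rule pa_automorphism.pa_ideal_image[OF pa_automorphism_shear_off pa_ideal_base_ideal])

lemma quotients_iso_sheared_ideals: "quotients_iso Q (sheared_ideal i) (sheared_ideal j)"
  unfolding sheared_ideal_def
  by (intro quotients_iso_automorphic_images pa_ideal_base_ideal pa_automorphism_shear_off)

lemma sheared_ideal_conv_span: "sheared_ideal i = pa.span (shear_off i ` base_relations)"
  by (simp add: sheared_ideal_def base_ideal_def pa_pair.linear_span_image[OF linear_shear_off])

lemma subspace_sheared_ideal: "pa.subspace (sheared_ideal i)"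
  by (simp add: sheared_ideal_conv_span)

lemma shear_off_base_relations_in_sheared_ideal:
  "f \<in> base_relations \<Longrightarrow> shear_off i f \<in> sheared_ideal i"
  by (simp add: sheared_ideal_conv_span pa.span_base)

definition grade :: "nat \<Rightarrow> path \<Rightarrow> word set" where
  "grade i p = {v. pres_eq (R i) (word_hom (label i) (fwd (snd p))) v}"

lemma grade_eq_iff: "grade i p = grade i q \<longleftrightarrow>
    pres_eq (R i) (word_hom (label i) (fwd (snd p))) (word_hom (label i) (fwd (snd q)))"
  unfolding grade_def by (auto intro: pe_refl pe_sym pe_trans)

lemma shear_off_basis_elt:
  assumes path: "is_path Q (x, as)"
  shows "(shear_off i (basis_elt (x, as)) :: path \<Rightarrow> 'k::field) \<in>
    path_span {p \<in> long_paths Q (length as). grade i p = grade i (x, as)}"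
proof -
  let ?sheared = "\<lambda>a b. b = a \<or> b = base a \<and> shift i a \<noteq> (0::'k)"
  interpret arrow_substitution Q "shear (shift i :: nat \<Rightarrow> 'k)" by (rule arrow_substitution_shear)
  have "word_hom (label i) (fwd bs) = word_hom (label i) (fwd as)"
    if "list_all2 ?sheared as bs" for bs
    using that by (induction rule: list_all2_induct) (auto simp: fwd_def label_base)
  then have "paths_between Q x (path_end Q (x, as)) \<inter> {x} \<times> {bs. list_all2 ?sheared as bs} \<subseteq>
      {p \<in> long_paths Q (length as). grade i p = grade i (x, as)}"
    by (auto simp: long_paths_def grade_def dest: list_all2_lengthD)
  then show ?thesis
    using path_span_Int[OF subst_basis_elt[OF path] arrow_subst_shear_basis_elt[OF path]]
      path_span_mono unfolding shear_off_def by blast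
qed

lemma shear_off_base_relations:
  assumes "f \<in> base_relations"
  shows "\<exists>d. shear_off i f \<in> path_span {p \<in> long_paths Q 2. grade i p = d}"
  using assms
proof (cases rule: base_relations.cases)
  case (mult j u v u' v')
  let ?p = "(0, [\<alpha> (tag j u), \<beta> (tag j v)]) :: path"
    and ?q = "(0, [\<alpha> (tag j u'), \<beta> (tag j v')]) :: path"
  have "grade i ?q = grade i ?p"
    unfolding grade_eq_iff using mult by (auto simp: fwd_def intro: pe_refl pe_sym)
  then show ?thesis
    using mult shear_off_basis_elt[of 0 "snd ?p" i] shear_off_basis_elt[of 0 "snd ?q" i]
    by (intro exI[of _ "grade i ?p"])
      (auto simp: pa_pair.linear_diff[OF linear_shear_off] tag_tags numeral_2_eq_2
        intro!: pa.subspace_diff)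
next
  case (left t)
  then show ?thesis
    using shear_off_basis_elt[of 0 "[\<alpha> (Some t), \<gamma>]" i] by (auto simp: numeral_2_eq_2)
next
  case (right t)
  then show ?thesis
    using shear_off_basis_elt[of 4 "[\<delta>, \<beta> (Some t)]" i] by (auto simp: numeral_2_eq_2)
qed

lemma admissible_sheared_ideal: "admissible Q (sheared_ideal i)"
proof (rule admissibleI[OF finite_quiver_Q pa_ideal_sheared_ideal, of _ 3])
  have "path_span {p \<in> long_paths Q 2. grade i p = d} \<subseteq> path_span (long_paths Q 2)" for d
    by (rule path_span_mono) blast
  then show "sheared_ideal i \<subseteq> path_span (long_paths Q 2)"
    unfolding sheared_ideal_conv_span
    using shear_off_base_relations by (intro pa.span_minimal) (blast, simp)
qed (use path_length_le_2 in \<open>force+\<close>)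

lemma grade_minimal_relation:
  assumes "minimal_relation Q (sheared_ideal i) \<rho>" "p \<in> supp \<rho>" "q \<in> supp \<rho>"
  shows "grade i p = grade i q"
proof (rule minimal_relation_homogeneous[OF _ assms[unfolded sheared_ideal_conv_span]])
  fix f assume "f \<in> shear_off i ` base_relations"
  moreover have "path_span {p \<in> long_paths Q 2. grade i p = d} \<subseteq> path_span {p. grade i p = d}"
    for d by (rule path_span_mono) blast
  ultimately show "\<exists>d. f \<in> path_span {p. grade i p = d}" using shear_off_base_relations by blast
qed

definition balanced_paths :: "path set" where
  "balanced_paths = (\<lambda>(s, t). (0, [\<alpha> s, \<beta> t])) ` (tags \<times> tags) \<union>
    {(0, [\<alpha> None, \<gamma>]), (4, [\<delta>, \<beta> None])}"

lemma finite_balanced_paths: "finite balanced_paths"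
  by (simp add: balanced_paths_def finite_tags)

lemma base_ideal_balanced:
  assumes "f \<in> base_ideal"
  shows "(\<Sum>p\<in>balanced_paths. f p) = 0"
proof -
  note finite = finite_balanced_paths
  have "(\<Sum>p\<in>balanced_paths. f p) = 0" if "f \<in> base_relations" for f
    using that
  proof (cases rule: base_relations.cases)
    case mult
    then show ?thesis
      using finite by (auto simp: sum_subtractf sum_basis_elt_apply balanced_paths_def tag_tags)
  qed (use finite in \<open>auto simp: sum_basis_elt_apply balanced_paths_def\<close>)
  moreover have "pa.subspace {f. (\<Sum>p\<in>balanced_paths. f p) = 0}"
    by (rule pa.subspaceI) (auto simp: sum.distrib pa_smult_def simp flip: sum_distrib_left)
  ultimately have "base_ideal \<subseteq> {f. (\<Sum>p\<in>balanced_paths. f p) = 0}"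
    unfolding base_ideal_def by (intro pa.span_minimal) auto
  then show ?thesis using assms by auto
qed

lemma balanced_not_in_sheared_ideal:
  assumes p: "(x, as) \<in> balanced_paths" "is_path Q (x, as)"
    and fixed: "\<And>e. e \<in> set as \<Longrightarrow> shift i e = (0 :: 'k::field)"
  shows "(basis_elt (x, as) :: path \<Rightarrow> 'k) \<notin> sheared_ideal i"
proof
  interpret pa_automorphism Q "shear_off i :: (path \<Rightarrow> 'k) \<Rightarrow> _" by (rule pa_automorphism_shear_off)
  let ?e = "basis_elt (x, as) :: path \<Rightarrow> 'k"
  assume "?e \<in> sheared_ideal i"
  then obtain h where h: "h \<in> base_ideal" "shear_off i h = ?e" by (auto simp: sheared_ideal_def)
  then have "h \<in> path_alg Q" using pa_ideal_base_ideal by (auto simp: pa_ideal_iff)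
  moreover have "?e \<in> path_alg Q" using p(2) by (rule basis_elt_in_path_alg)
  moreover have "shear_off i ?e = ?e" using p(2) fixed by (rule shear_off_fixed)
  ultimately have "h = ?e" using inj h(2) by (metis inj_onD)
  then have "(\<Sum>p\<in>balanced_paths. ?e p) = 0" using base_ideal_balanced h(1) by blast
  then show False using p(1) by (simp add: sum_basis_elt_apply finite_balanced_paths)
qed

lemma htpy_mult:
  assumes i: "i < n" and words: "u \<in> words i" "v \<in> words i" "u' \<in> words i" "v' \<in> words i"
    and eq: "pres_eq (R i) (u @ v) (u' @ v')"
  shows "htpy Q (sheared_ideal i :: (path \<Rightarrow> 'k::field) set)
    (0, [(\<alpha> (tag i u), True), (\<beta> (tag i v), True)])
    (0, [(\<alpha> (tag i u'), True), (\<beta> (tag i v'), True)])"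
proof -
  let ?p = "(0, [\<alpha> (tag i u), \<beta> (tag i v)]) :: path"
    and ?q = "(0, [\<alpha> (tag i u'), \<beta> (tag i v')]) :: path"
  have paths: "is_path Q ?p" "is_path Q ?q" using i words by (simp_all add: tag_tags)
  then have "shear_off i (basis_elt ?p) = (basis_elt ?p :: path \<Rightarrow> 'k)"
      "shear_off i (basis_elt ?q) = (basis_elt ?q :: path \<Rightarrow> 'k)"
    by (auto intro!: shear_off_fixed)
  moreover have "shear_off i (basis_elt ?p - basis_elt ?q) \<in> (sheared_ideal i :: (path \<Rightarrow> 'k) set)"
    using base_relations.mult[OF assms] by (rule shear_off_base_relations_in_sheared_ideal)
  ultimately have "basis_elt ?p - basis_elt ?q \<in> (sheared_ideal i :: (path \<Rightarrow> 'k) set)"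
    by (simp add: pa_pair.linear_diff[OF linear_shear_off])
  moreover have "(basis_elt ?q :: path \<Rightarrow> 'k) \<notin> sheared_ideal i"
    using paths i words
    by (intro balanced_not_in_sheared_ideal) (auto simp: balanced_paths_def tag_tags)
  ultimately show ?thesis
    using htpy_binomial[OF paths(1) subspace_sheared_ideal, of ?q] paths by (simp add: fwd_def)
qed

lemma shear_off_monomials:
  assumes "Some (j, u) \<in> tags" "j \<noteq> i"
  shows "shear_off i (basis_elt (0, [\<alpha> (Some (j, u)), \<gamma>])) =
      basis_elt (0, [\<alpha> (Some (j, u)), \<gamma>]) - basis_elt (0, [\<alpha> None, \<gamma>])"
    and "shear_off i (basis_elt (4, [\<delta>, \<beta> (Some (j, u))])) =
      basis_elt (4, [\<delta>, \<beta> (Some (j, u))]) - basis_elt (4, [\<delta>, \<beta> None])"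
  using assms by (simp_all add: shear_off_def shear_def arrow_elt_conv_basis_elt pa_mult_diff_left
      pa_mult_diff_right pa_mult_basis_elt is_path_Cons path_end_Cons)

lemma htpy_off:
  assumes "Some (j, u) \<in> tags" "j \<noteq> i"
  shows "htpy Q (sheared_ideal i :: (path \<Rightarrow> 'k::field) set)
      (0, [(\<alpha> (Some (j, u)), True), (\<gamma>, True)]) (0, [(\<alpha> None, True), (\<gamma>, True)])"
    and "htpy Q (sheared_ideal i :: (path \<Rightarrow> 'k::field) set)
      (4, [(\<delta>, True), (\<beta> (Some (j, u)), True)]) (4, [(\<delta>, True), (\<beta> None, True)])"
proof -
  let ?p = "(0, [\<alpha> (Some (j, u)), \<gamma>]) :: path" and ?q = "(0, [\<alpha> None, \<gamma>]) :: path"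
  let ?p' = "(4, [\<delta>, \<beta> (Some (j, u))]) :: path" and ?q' = "(4, [\<delta>, \<beta> None]) :: path"
  have "basis_elt ?p - basis_elt ?q \<in> (sheared_ideal i :: (path \<Rightarrow> 'k) set)"
      "basis_elt ?p' - basis_elt ?q' \<in> (sheared_ideal i :: (path \<Rightarrow> 'k) set)"
    unfolding shear_off_monomials[OF assms, symmetric]
    by (intro shear_off_base_relations_in_sheared_ideal base_relations.left base_relations.right
        assms)+
  moreover have "(basis_elt ?q :: path \<Rightarrow> 'k) \<notin> sheared_ideal i"
      "(basis_elt ?q' :: path \<Rightarrow> 'k) \<notin> sheared_ideal i"
    by (rule balanced_not_in_sheared_ideal; auto simp: balanced_paths_def)+
  ultimately show "htpy Q (sheared_ideal i :: (path \<Rightarrow> 'k) set)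
      (0, [(\<alpha> (Some (j, u)), True), (\<gamma>, True)]) (0, [(\<alpha> None, True), (\<gamma>, True)])"
    "htpy Q (sheared_ideal i :: (path \<Rightarrow> 'k) set)
      (4, [(\<delta>, True), (\<beta> (Some (j, u)), True)]) (4, [(\<delta>, True), (\<beta> None, True)])"
    using htpy_binomial[OF _ subspace_sheared_ideal, of Q ?p ?q i]
      htpy_binomial[OF _ subspace_sheared_ideal, of Q ?p' ?q' i] assms(1)
    by (simp_all add: fwd_def)
qed

end

section \<open>The fundamental groups\<close>

locale presentation_family_member = presentation_family n X R for n X R +
  fixes i :: nat
    and J :: "(path \<Rightarrow> 'k::field) set" \<comment> \<open>makes the field a parameter of the locale\<close>
  assumes i: "i < n" and J: "J = sheared_ideal i"
begin

sublocale bound_quiver Q J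
  by standard (use finite_quiver_Q pa_ideal_sheared_ideal[of i] in \<open>auto simp: J pa_ideal_iff\<close>)

abbreviation a :: "tag \<Rightarrow> nat \<times> bool" where "a t \<equiv> (\<alpha> t, True)"
abbreviation b :: "tag \<Rightarrow> nat \<times> bool" where "b t \<equiv> (\<beta> t, True)"
abbreviation c :: "nat \<times> bool" where "c \<equiv> (\<gamma>, True)"
abbreviation d :: "nat \<times> bool" where "d \<equiv> (\<delta>, True)"

lemma tag_i_tags [simp]: "u \<in> words i \<Longrightarrow> tag i u \<in> tags"
  using i by (rule tag_tags)

lemma homotopic_ab:
  "u \<in> words i \<Longrightarrow> v \<in> words i \<Longrightarrow> u' \<in> words i \<Longrightarrow> v' \<in> words i \<Longrightarrow>
    pres_eq (R i) (u @ v) (u' @ v') \<Longrightarrow>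
    homotopic 0 [a (tag i u), b (tag i v)] [a (tag i u'), b (tag i v')]"
  unfolding J using i by (rule htpy_mult)

lemma homotopic_a_off:
  assumes "Some (j, u) \<in> tags" "j \<noteq> i"
  shows "homotopic 0 [a (Some (j, u))] [a None]"
proof (rule homotopic_cancel_right[of _ _ "[c]"])
  show "homotopic 0 ([a (Some (j, u))] @ [c]) ([a None] @ [c])"
    using htpy_off(1)[OF assms] by (simp add: J)
qed (use assms in simp_all)

lemma homotopic_b_off:
  assumes "Some (j, u) \<in> tags" "j \<noteq> i"
  shows "homotopic 1 [b (Some (j, u))] [b None]"
proof (rule homotopic_cancel_left)
  show "homotopic 4 ([d] @ [b (Some (j, u))]) ([d] @ [b None])"
    using htpy_off(2)[OF assms] by (simp add: J)
qed simp

definition loop :: "word \<Rightarrow> word" where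
  "loop u = [a (tag i u)] @ inv_word [a None]"

lemma walk_end_loop [simp]: "u \<in> words i \<Longrightarrow> walk_end Q 0 (loop u) = Some 0"
  by (simp add: loop_def)

lemma homotopic_loop_a: "u \<in> words i \<Longrightarrow> homotopic 0 (loop u @ [a None]) [a (tag i u)]"
  using homotopic_append_left[OF homotopic_left_inverse[of 0 "[a None]" 1], of 0 "[a (tag i u)]"]
  by (simp add: loop_def)

lemma homotopic_loop_mult:
  assumes words: "u \<in> words i" "v \<in> words i" "w \<in> words i" and eq: "pres_eq (R i) (u @ v) w"
  shows "homotopic 0 (loop u @ loop v) (loop w)"
proof (rule homotopic_cancel_right)
  have "homotopic 0 (loop u @ (loop v @ [a None]) @ [b None]) (loop u @ [a (tag i v)] @ [b None])"
    using words homotopic_append_right[OF homotopic_loop_a[OF words(2)], of 1 "[b None]" 2]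
    by (intro homotopic_append_left) (simp_all add: walk_end_append)
  also have "homotopic 0 (loop u @ [a (tag i v)] @ [b None]) (loop u @ [a None, b (tag i v)])"
    using words homotopic_ab[of v "[]" "[]" v]
    by (intro homotopic_append_left) (simp_all add: pe_refl)
  also have "homotopic 0 (loop u @ [a None, b (tag i v)]) [a (tag i u), b (tag i v)]"
    using words homotopic_append_right[OF homotopic_loop_a[OF words(1)], of 1 "[b (tag i v)]" 2]
    by (simp add: walk_end_append)
  also have "homotopic 0 [a (tag i u), b (tag i v)] [a (tag i w), b None]"
    using homotopic_ab[of u v w "[]"] words eq by simp
  also have "homotopic 0 [a (tag i w), b None] (loop w @ [a None, b None])"
    using words h_sym[OF homotopic_append_right[OF homotopic_loop_a[OF words(3)], of 1 "[b None]" 2]]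
    by (simp add: walk_end_append)
  finally show "homotopic 0 ((loop u @ loop v) @ [a None, b None]) (loop w @ [a None, b None])"
    by simp
qed (use words in \<open>simp_all add: walk_end_append\<close>)

lemma homotopic_loop_Nil: "homotopic 0 (loop []) []"
  using homotopic_right_inverse[of 0 "[a None]" 1] by (simp add: loop_def)

lemma homotopic_loop_relator:
  assumes "r \<in> R i"
  shows "homotopic 0 (loop r) []"
proof -
  have "pres_eq (R i) ([] @ r @ []) ([] @ [])" using assms by (rule pe_rel)
  then have "homotopic 0 (loop r @ loop []) (loop [])"
    using relator_words[OF i assms] by (intro homotopic_loop_mult) simp_all
  then have "homotopic 0 (loop r @ loop []) ([] @ loop [])" by simp
  then show ?thesis
    by (rule homotopic_cancel_right) (use relator_words[OF i assms] in simp_all)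
qed

definition gen :: "nat \<Rightarrow> word" where
  "gen x = (if x \<in> X i then loop [(x, True)] else [])"

lemma walk_end_gen: "walk_end Q 0 (gen x) = Some 0"
  by (simp add: gen_def letter_words[OF i])

lemma homotopic_loop_letter:
  assumes x: "x \<in> X i"
  shows "homotopic 0 (loop [(x, e)]) (word_hom gen [(x, e)])"
proof (cases e)
  case True
  then show ?thesis using x by (auto simp: gen_def letter_words[OF i] intro: homotopic_refl)
next
  case False
  note words = letter_words[OF i x]
  let ?g = "loop [(x, True)]"
  have "homotopic 0 (?g @ loop [(x, False)]) (loop [])"
    using words pe_cancel[of "R i" "[]" x True "[]"] by (intro homotopic_loop_mult) simp_all
  also have "homotopic 0 (loop []) []" by (rule homotopic_loop_Nil)
  also have "homotopic 0 [] (?g @ inv_word ?g)"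
    using words by (intro h_sym[OF homotopic_right_inverse]) simp
  finally have "homotopic 0 (loop [(x, False)]) (inv_word ?g)"
    by (rule homotopic_cancel_left) (use words in simp)
  then show ?thesis using False x by (simp add: gen_def)
qed

lemma homotopic_loop: "u \<in> words i \<Longrightarrow> homotopic 0 (loop u) (word_hom gen u)"
proof (induction u)
  case Nil
  show ?case using homotopic_loop_Nil by simp
next
  case (Cons l u)
  obtain x e where l: "l = (x, e)" by (cases l)
  have x: "x \<in> X i" and u: "u \<in> words i" using Cons.prems by (auto simp: words_def l)
  note words = Cons.prems letter_words[OF i x, of e, folded l] u
  have "homotopic 0 (loop (l # u)) (loop [l] @ loop u)"
    using words by (intro h_sym[OF homotopic_loop_mult]) (simp_all add: pe_refl)
  also have "homotopic 0 (loop [l] @ loop u) (word_hom gen [l] @ word_hom gen u)"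
    using words homotopic_loop_letter[OF x, of e, folded l] Cons.IH[OF u]
    by (intro homotopic_append) simp_all
  finally show ?case by (simp add: l)
qed

lemma homotopic_a:
  assumes "t \<in> tags"
  shows "homotopic 0 [a t] (word_hom gen (tag_label i t) @ [a None])"
  using assms i
proof (cases rule: tags_cases)
  case (on u)
  have "homotopic 0 [a t] (loop u @ [a None])"
    using h_sym[OF homotopic_loop_a[OF on(2)]] on(1) by simp
  also have "homotopic 0 (loop u @ [a None]) (word_hom gen u @ [a None])"
    using on(2) by (intro homotopic_append_right[OF homotopic_loop, where y = 0 and z = 1]) simp_all
  finally show ?thesis using on by simp
next
  case (off j u)
  then show ?thesis using homotopic_a_off assms by simp
qed

lemma homotopic_b:
  assumes "t \<in> tags"
  shows "homotopic 0 [a None, b t] (word_hom gen (tag_label i t) @ [a None, b None])"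
  using assms i
proof (cases rule: tags_cases)
  case (on u)
  have "homotopic 0 [a None, b t] ([a t] @ [b None])"
    using homotopic_ab[of "[]" u u "[]"] on by (simp add: pe_refl)
  also have "homotopic 0 ([a t] @ [b None]) ((word_hom gen u @ [a None]) @ [b None])"
    using homotopic_append_right[OF homotopic_a[OF assms], of 1 "[b None]" 2] on assms by simp
  finally show ?thesis using on by simp
next
  case (off j u)
  then show ?thesis
    using homotopic_append_left[OF homotopic_b_off, of j u 0 "[a None]"] assms by simp
qed

lemma homotopy_presentation: "homotopy_presentation Q J 0 (X i) (R i) (label i) gen tree"
proof
  show "label i e \<in> lists (X i \<times> UNIV)" if "e \<in> arrs Q" for e
    using that
    by (cases rule: arrs_cases) (auto elim!: tags_cases[OF _ i] simp: words_def)
  show "pres_eq (R i) (word_hom (label i) (fwd (snd p))) (word_hom (label i) (fwd (snd q)))"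
    if "minimal_relation Q J \<rho>" "p \<in> supp \<rho>" "q \<in> supp \<rho>" for \<rho> p q
    using grade_minimal_relation[OF that[unfolded J]] by (simp add: grade_eq_iff)
  show "walk_end Q 0 (gen x) = Some 0" for x by (rule walk_end_gen)
  show "word_hom (label i) (gen x) = [(x, True)]" if "x \<in> X i" for x
    using that by (simp add: gen_def loop_def)
  show "homotopic 0 (word_hom gen r) []" if "r \<in> R i" for r
    using homotopic_loop[OF relator_words[OF i that]] homotopic_loop_relator[OF that]
    by (blast intro: h_sym h_trans)
  show "walk_end Q 0 (tree v) = Some v" if "v \<in> verts Q" for v using that by (rule walk_end_tree)
  show "word_hom (label i) (tree v) = []" if "v \<in> verts Q" for v
    using that by (auto simp: tree_def)
  show "homotopic 0 (tree (src Q e) @ [(e, True)]) (word_hom gen (label i e) @ tree (tgt Q e))"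
    if "e \<in> arrs Q" for e
    using that
  proof (cases rule: arrs_cases)
    case (Alpha t)
    then show ?thesis using homotopic_a by (simp add: tree_def)
  next
    case (Beta t)
    then show ?thesis using homotopic_b by (simp add: tree_def)
  next
    case Gamma
    then show ?thesis by (auto simp: tree_def intro: homotopic_refl)
  next
    case Delta
    then show ?thesis
      using homotopic_append_left[OF homotopic_left_inverse[of 4 "[d]" 1], of 0 "[a None]"]
      by (simp add: tree_def)
  qed
qed

end

lemma (in presentation_family) pi1_sheared_ideal_iso:
  assumes "i < n" "v \<in> verts Q"
  shows "pi1 Q (sheared_ideal i :: (path \<Rightarrow> 'k::field) set) v \<cong> presented_group (X i) (R i)"
proof -
  interpret presentation_family_member n X R i "sheared_ideal i :: (path \<Rightarrow> 'k) set"
    by standard (simp_all add: assms)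
  show ?thesis
    using homotopy_presentation assms(2) by (rule homotopy_presentation.pi1_iso_presented_group)
qed

theorem theorem1:
  fixes Gs :: "nat \<Rightarrow> ('g, 'm) monoid_scheme" and n :: nat
  assumes "alg_closed_field TYPE('k::field)"
    and "\<forall>i<n. finitely_presented (Gs i)"
  shows "\<exists>Q. finite_quiver Q \<and> connected_quiver Q \<and> no_oriented_cycles Q \<and>
    (\<exists>I :: nat \<Rightarrow> (path \<Rightarrow> 'k) set.
       (\<forall>i<n. admissible Q (I i)) \<and>
       (\<forall>i<n. \<forall>j<n. quotients_iso Q (I i) (I j)) \<and>
       (\<forall>i<n. \<forall>v0\<in>verts Q. pi1 Q (I i) v0 \<cong> Gs i))"
proof -
  have "\<exists>X R. finite X \<and> finite R \<and> R \<subseteq> lists (X \<times> UNIV) \<and> Gs i \<cong> presented_group X R"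
    if "i < n" for i using assms(2) that by (auto simp: finitely_presented_def)
  then obtain X R where presentations: "finite (X i)" "finite (R i)" "R i \<subseteq> lists (X i \<times> UNIV)"
      "Gs i \<cong> presented_group (X i) (R i)" if "i < n" for i
    by metis
  interpret presentation_family n X R by standard (use presentations in auto)
  have "pi1 Q (sheared_ideal i :: (path \<Rightarrow> 'k) set) v \<cong> Gs i" if "i < n" "v \<in> verts Q" for i v
  proof -
    have "pi1 Q (sheared_ideal i :: (path \<Rightarrow> 'k) set) v \<cong> presented_group (X i) (R i)"
      using that by (rule pi1_sheared_ideal_iso)
    also have "presented_group (X i) (R i) \<cong> Gs i"
      using assms(2) presentations(4) that by (auto simp: finitely_presented_def intro: group.iso_sym)
    finally show ?thesis .
  qed
  then show ?thesis
    using finite_quiver_Q connected_quiver_Q no_oriented_cycles_Q admissible_sheared_ideal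
      quotients_iso_sheared_ideals
    by (intro exI[of _ Q] conjI exI[of _ sheared_ideal]) auto
qed

end
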